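(* Let $(X,\mathcal{B},\mu,T)$ be a rank one system of finite measure approximated by a sequence of towers $S_n$ with base $F_n$ and height $h_n$. (i) Let $A=\{t_n\}$ be a strictly increasing subexponential sequence of non-negative integers. If $$\limsup_{n\to\infty}\frac{\log h_{n+1}}{\log h_n}<\infty,$$ then $h^A(T)=0$. (ii) Let $A=\{t_n\}$ be a strictly increasing sequence of non-negative integers with $t_n=O(n^\alpha)$ for some $\alpha>1$. If there exists $\beta\in\left(0,\frac1{\alpha-1}\right)$ such that $$\limsup_{n\to\infty}\frac{\log h_{n+1}}{h_n^{\beta}}<\infty,$$ then $h^A(T)=0$. (iii) Let $A=\{t_n\}$ where $t_n=\lfloor Cn(\log n)^\alpha\rfloor$ for some $C,\alpha>0$. If there exists $\beta\in\left(0,\frac1\alpha\right)$ such that $$\limsup_{n\to\infty}\frac{\log h_{n+1}}{e^{h_n^{\beta}}}<\infty,$$ then $h^A(T)=0$.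
   Context: **Systems.** $(X,\mathcal{B},\mu)$ is a standard measure space with $0<\mu(X)<\infty$ and $T$ is an invertible measure-preserving transformation. Set equalities are modulo null sets. **Subexponential.** A sequence $\{t_n\}$ is subexponential if $\lim_{n\to\infty}\frac1n\log t_n=0$. **Sequence entropy.** Let $f(0)=0$ and $f(x)=-x\log x$ for $x>0$. For a finite measurable partition $\xi=\{X_1,\dots,X_m\}$ put $H(\xi)=\sum_{i=1}^m f(\mu(X_i))$. For a sequence $A=\{t_n\}_{n\ge1}$ of non-negative integers put $$h^A(T,\xi)=\limsup_{n\to\infty}\frac1n H\Big(\bigvee_{k=1}^n T^{-t_k}\xi\Big),\qquad h^A(T)=\sup_\xi h^A(T,\xi),$$ the supremum being over all finite measurable partitions $\xi$ of $X$. (The sequence in (iii) is strictly increasing from some index on; the same formula is used.) **Rank one systems.** $(X,\mathcal{B},\mu,T)$ is a rank one system approximated by towers $S_n$ with base $F_n$ and height $h_n$ if there are integers $h_1\ge1$, $q_n\ge1$ ($n\ge1$) and $a_{n,i}\ge0$ ($n\ge1$, $1\le i\le q_n-1$) such that, with $a_n=\sum_{i=1}^{q_n-1}a_{n,i}$ and $h_{n+1}=q_nh_n+a_n$, the sequence $h_n$ is strictly increasing and $\sum_{n}a_n/h_{n+1}<\infty$, and measurable sets $F_n$ of positive measure such that for all $n\ge 1$: (a) $F_n,TF_n,\dots,T^{h_n-1}F_n$ are pairwise disjoint; their union is the tower $S_n$ with base $F_n$ and height $h_n$; (b) $F_n$ is partitioned into measurable sets $F_{n,1},\dots,F_{n,q_n}$;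 (c) $T^{h_n+a_{n,i}}F_{n,i}=F_{n,i+1}$ for $1\le i\le q_n-1$ (the sets $T^{h_n+j}F_{n,i}$, $0\le j<a_{n,i}$, are the spacer levels of $S_{n+1}$); (d) $F_{n+1}=F_{n,1}$; (e) the partitions $\xi_n=\{F_n,TF_n,\dots,T^{h_n-1}F_n,X\setminus S_n\}$ form a refining sequence converging to the partition into points (i.e. they generate $\mathcal{B}$ modulo null sets). *)

theory Defs
  imports "HOL-Analysis.Analysis" "HOL-Library.Landau_Symbols" "HOL-Library.Disjoint_Sets"
begin

text \<open>A standard measure space: the \<open>\<sigma>\<close>-algebra lies between the Borel sets of some Polish topology
  on the underlying set and the completion of these Borel sets, so that both standard Borel spaces
  and their completions (Lebesgue spaces) are covered.\<close>

definition standard_measure_space :: "'a measure \<Rightarrow> bool" where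
  "standard_measure_space M \<longleftrightarrow>
     (\<exists>\<tau>. topspace \<tau> = space M \<and> completely_metrizable_space \<tau> \<and> second_countable \<tau> \<and>
          sigma_sets (space M) {U. openin \<tau> U} \<subseteq> sets M \<and>
          (\<forall>A\<in>sets M. \<exists>B\<in>sigma_sets (space M) {U. openin \<tau> U}.
             \<exists>C\<in>sigma_sets (space M) {U. openin \<tau> U}.
               B \<subseteq> A \<and> A \<subseteq> C \<and> C - B \<in> null_sets M))"

definition invertible_measure_preserving :: "'a measure \<Rightarrow> ('a \<Rightarrow> 'a) \<Rightarrow> bool" where
  "invertible_measure_preserving M T \<longleftrightarrow>
     bij_betw T (space M) (space M) \<and> T \<in> measurable M M \<and>
     the_inv_into (space M) T \<in> measurable M M \<and>
     (\<forall>A\<in>sets M. emeasure M (T -` A \<inter> space M) = emeasure M A)"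

definition null_eq :: "'a measure \<Rightarrow> 'a set \<Rightarrow> 'a set \<Rightarrow> bool" where
  "null_eq M A B \<longleftrightarrow> sym_diff A B \<in> null_sets M"

text \<open>Sequences indexed by the integers \<open>n \<ge> 1\<close> are functions on \<^typ>\<open>nat\<close> whose value at
  \<open>0\<close> is irrelevant.\<close>

definition subexponential :: "(nat \<Rightarrow> nat) \<Rightarrow> bool" where
  "subexponential t \<longleftrightarrow> (\<lambda>n. ln (real (t n)) / real n) \<longlonglongrightarrow> 0"


subsection \<open>Sequence entropy\<close>

definition entropy_fun :: "real \<Rightarrow> real" where
  "entropy_fun x = (if x = 0 then 0 else - x * ln x)"

definition finite_measurable_partition :: "'a measure \<Rightarrow> 'a set set \<Rightarrow> bool" where
  "finite_measurable_partition M \<xi> \<longleftrightarrow> finite \<xi> \<and> \<xi> \<subseteq> sets M \<and> partition_on (space M) \<xi>"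

definition partition_entropy :: "'a measure \<Rightarrow> 'a set set \<Rightarrow> real" where
  "partition_entropy M \<xi> = (\<Sum>C\<in>\<xi>. entropy_fun (measure M C))"

definition preimage_partition :: "'a measure \<Rightarrow> ('a \<Rightarrow> 'a) \<Rightarrow> nat \<Rightarrow> 'a set set \<Rightarrow> 'a set set" where
  "preimage_partition M T k \<xi> = (\<lambda>C. (T ^^ k) -` C \<inter> space M) ` \<xi>"

definition sequence_entropy_wrt ::
  "'a measure \<Rightarrow> ('a \<Rightarrow> 'a) \<Rightarrow> (nat \<Rightarrow> nat) \<Rightarrow> 'a set set \<Rightarrow> ereal" where
  "sequence_entropy_wrt M T t \<xi> =
     limsup (\<lambda>n. ereal (1 / real n *
       partition_entropy M (common_refinement ((\<lambda>k. preimage_partition M T (t k) \<xi>) ` {1..n}))))"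

definition sequence_entropy :: "'a measure \<Rightarrow> ('a \<Rightarrow> 'a) \<Rightarrow> (nat \<Rightarrow> nat) \<Rightarrow> ereal" where
  "sequence_entropy M T t = (SUP \<xi>\<in>{\<xi>. finite_measurable_partition M \<xi>}. sequence_entropy_wrt M T t \<xi>)"


subsection \<open>Rank one systems\<close>

definition tower :: "('a \<Rightarrow> 'a) \<Rightarrow> (nat \<Rightarrow> 'a set) \<Rightarrow> (nat \<Rightarrow> nat) \<Rightarrow> nat \<Rightarrow> 'a set" where
  "tower T F h n = (\<Union>j<h n. (T ^^ j) ` F n)"

definition tower_partition ::
  "'a measure \<Rightarrow> ('a \<Rightarrow> 'a) \<Rightarrow> (nat \<Rightarrow> 'a set) \<Rightarrow> (nat \<Rightarrow> nat) \<Rightarrow> nat \<Rightarrow> 'a set set" where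
  "tower_partition M T F h n =
     insert (space M - tower T F h n) ((\<lambda>j. (T ^^ j) ` F n) ` {..<h n})"

text \<open>All set relations are modulo null sets. In the last two clauses, the partitions are refining,
  and their cells generate the \<open>\<sigma>\<close>-algebra modulo null sets.\<close>

definition rank_one_approximated ::
  "'a measure \<Rightarrow> ('a \<Rightarrow> 'a) \<Rightarrow> (nat \<Rightarrow> 'a set) \<Rightarrow> (nat \<Rightarrow> nat) \<Rightarrow> bool" where
  "rank_one_approximated M T F h \<longleftrightarrow>
     (\<exists>(q :: nat \<Rightarrow> nat) (a :: nat \<Rightarrow> nat \<Rightarrow> nat) (G :: nat \<Rightarrow> nat \<Rightarrow> 'a set).
        h 1 \<ge> 1 \<and>
        (\<forall>n\<ge>1. q n \<ge> 1 \<and> h (Suc n) = q n * h n + (\<Sum>i = 1..q n - 1. a n i)) \<and>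
        (\<forall>n\<ge>1. h n < h (Suc n)) \<and>
        summable (\<lambda>n. real (\<Sum>i = 1..q n - 1. a n i) / real (h (Suc n))) \<and>
        (\<forall>n\<ge>1. F n \<in> sets M \<and> emeasure M (F n) > 0) \<and>
        (\<forall>n\<ge>1. \<forall>i<h n. \<forall>j<h n. i \<noteq> j \<longrightarrow> (T ^^ i) ` F n \<inter> (T ^^ j) ` F n \<in> null_sets M) \<and>
        (\<forall>n\<ge>1. (\<forall>i\<in>{1..q n}. G n i \<in> sets M) \<and>
           (\<forall>i\<in>{1..q n}. \<forall>j\<in>{1..q n}. i \<noteq> j \<longrightarrow> G n i \<inter> G n j \<in> null_sets M) \<and>
           null_eq M (\<Union>i\<in>{1..q n}. G n i) (F n)) \<and>
        (\<forall>n\<ge>1. \<forall>i\<in>{1..q n - 1}. null_eq M ((T ^^ (h n + a n i)) ` G n i) (G n (Suc i))) \<and>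
        (\<forall>n\<ge>1. null_eq M (F (Suc n)) (G n 1)) \<and>
        (\<forall>n\<ge>1. \<forall>A\<in>tower_partition M T F h n.
           \<exists>\<C>\<subseteq>tower_partition M T F h (Suc n). null_eq M A (\<Union>\<C>)) \<and>
        (\<forall>A\<in>sets M. \<exists>B\<in>sigma_sets (space M) (\<Union>n\<in>{1..}. tower_partition M T F h n).
           null_eq M A B))"

end

theory Submission
  imports Defs "HOL-Real_Asymp.Real_Asymp"
begin

text \<open>An orbit enters the base of a tower of height \<open>h\<close> at most once in \<open>h\<close> steps, so modulo null
  sets the history of its tower positions during the times \<open>0, \<dots>, t n\<close> takes at most
  \<open>(h + 1) ^ (t n div h + 2)\<close> values. Every finite partition is determined, up to a small set, by
  the position in a sufficiently late tower; hence Gibbs' inequality bounds the entropy of its joined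
  preimages by \<open>(t n / h + 2) * ln (h + 1)\<close> up to an arbitrarily small multiple of \<open>n\<close>. The growth
  conditions allow the height \<open>h\<close> to be chosen, depending on \<open>n\<close>, such that this is \<open>o(n)\<close>.\<close>


subsection \<open>Entropy of joined preimages\<close>

text \<open>No fixed height serves all n: a bounded \<open>h m\<close> costs about
  \<open>t n / h m * ln (h m)\<close>, too much when \<open>t n\<close> outgrows n, while for a huge
  \<open>h m\<close> the term \<open>ln (h m)\<close> alone is too much. When \<open>t n\<close>
  lies between \<open>h m\<close> and \<open>h (Suc m)\<close>, these two levels are tried. The
  upper one costs at most \<open>3 * ln (h (Suc m) + 1)\<close> and is good as long as
  \<open>ln (h (Suc m))\<close> is small against n. In (i) this always holds, because
  \<open>ln (h (Suc m))\<close> is at most a constant times \<open>ln (t n)\<close>. In (ii) and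
  (iii) its failure forces \<open>h m\<close> up to the order of n^(1/\<beta>), respectively (ln
  n)^(1/\<beta>). Up to the factor \<open>ln (h m)\<close> the code length is then of order
  n^(\<alpha> - 1/\<beta>), respectively n (ln n)^(\<alpha> - 1/\<beta>), and these are o(n) exactly
  when \<beta> < 1/(\<alpha> - 1), respectively \<beta> < 1/\<alpha>. The exceptional set E stays
  harmless however sparse the sequence is: codes cover all times up to \<open>t n\<close>, but
  visits to E are counted only at the n times \<open>t k\<close>, and by invariance they contribute
  \<open>n * measure M E\<close>.\<close>

definition name_cell :: "'a measure \<Rightarrow> ('i \<Rightarrow> 'a \<Rightarrow> 'a) \<Rightarrow> 'i set \<Rightarrow> ('i \<Rightarrow> 'a set) \<Rightarrow> 'a set" where
  "name_cell M S I w = {x \<in> space M. \<forall>k\<in>I. S k x \<in> w k}"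

lemma partition_on_unique:
  assumes "partition_on A P" "C \<in> P" "D \<in> P" "x \<in> C" "x \<in> D"
  shows "C = D"
  using assms by (meson disjnt_iff partition_on_def pairwiseD)

lemma name_cell_unique:
  assumes "partition_on (space M) \<xi>" "w \<in> I \<rightarrow>\<^sub>E \<xi>" "w' \<in> I \<rightarrow>\<^sub>E \<xi>"
    "x \<in> name_cell M S I w" "x \<in> name_cell M S I w'"
  shows "w = w'"
proof (rule PiE_ext[OF assms(2,3)])
  fix k assume "k \<in> I"
  then show "w k = w' k"
    using assms by (intro partition_on_unique[OF assms(1), of _ _ "S k x"]) (auto simp: name_cell_def)
qed

text \<open>\<open>common_refinement\<close> selects one cell per partition, a word one cell per
  index. The two agree although different indices may give the same partition: if a name cell
  contains a point x, its letters at such indices have preimages that contain x and lie in one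
  partition, so they coincide. Words that violate this have empty name cells, which both sides
  discard.\<close>

lemma common_refinement_vimage_eq_name_cells:
  assumes P: "partition_on (space M) \<xi>" and S: "\<And>k. k \<in> I \<Longrightarrow> S k \<in> space M \<rightarrow> space M" and "I \<noteq> {}"
  shows "common_refinement ((\<lambda>k. (\<lambda>C. S k -` C \<inter> space M) ` \<xi>) ` I)
           = name_cell M S I ` (I \<rightarrow>\<^sub>E \<xi>) - {{}}"
proof (intro equalityI subsetI)
  let ?P = "\<lambda>k. (\<lambda>C. S k -` C \<inter> space M) ` \<xi>"
  fix X assume "X \<in> common_refinement (?P ` I)"
  then obtain f where f: "\<And>k. k \<in> I \<Longrightarrow> f (?P k) \<in> ?P k" and X: "X = \<Inter> (f ` ?P ` I)" and ne: "X \<noteq> {}"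
    by (auto simp: common_refinement_def PiE_iff)
  have "\<forall>k\<in>I. \<exists>C\<in>\<xi>. f (?P k) = S k -` C \<inter> space M"
    using f by blast
  then obtain w where w: "\<And>k. k \<in> I \<Longrightarrow> w k \<in> \<xi> \<and> f (?P k) = S k -` w k \<inter> space M"
    by metis
  have "X = (\<Inter>k\<in>I. S k -` w k \<inter> space M)"
    unfolding X using w by auto
  also have "\<dots> = name_cell M S I (restrict w I)"
    using \<open>I \<noteq> {}\<close> by (auto simp: name_cell_def)
  finally show "X \<in> name_cell M S I ` (I \<rightarrow>\<^sub>E \<xi>) - {{}}"
    using ne w by auto
next
  let ?P = "\<lambda>k. (\<lambda>C. S k -` C \<inter> space M) ` \<xi>"
  fix X assume "X \<in> name_cell M S I ` (I \<rightarrow>\<^sub>E \<xi>) - {{}}"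
  then obtain w where w: "w \<in> I \<rightarrow>\<^sub>E \<xi>" and X: "X = name_cell M S I w" and "X \<noteq> {}" by blast
  then obtain x where x: "x \<in> X" by blast
  \<comment> \<open>Selecting by the point x instead of by an index makes f a function of the
    partition alone.\<close>
  define f where "f = (\<lambda>Q. THE C. C \<in> Q \<and> x \<in> C)"
  have f: "f (?P k) = S k -` w k \<inter> space M" if "k \<in> I" for k
    unfolding f_def
  proof (rule the_equality)
    show "S k -` w k \<inter> space M \<in> ?P k \<and> x \<in> S k -` w k \<inter> space M"
      using that w x X by (auto simp: name_cell_def)
    fix D assume "D \<in> ?P k \<and> x \<in> D"
    then obtain C where "C \<in> \<xi>" "D = S k -` C \<inter> space M" "S k x \<in> C" by auto
    moreover from this have "C = w k"
      using that w x X by (intro partition_on_unique[OF P, of _ _ "S k x"]) (auto simp: name_cell_def)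
    ultimately show "D = S k -` w k \<inter> space M" by simp
  qed
  have "f \<in> (\<Pi> Q\<in>?P ` I. Q)"
    using f w by auto
  moreover have "X = \<Inter> (f ` ?P ` I)"
    using f \<open>I \<noteq> {}\<close> by (auto simp: X name_cell_def)
  ultimately show "X \<in> common_refinement (?P ` I)"
    using \<open>X \<noteq> {}\<close> unfolding common_refinement by auto
qed

text \<open>Two words with the same name cell both have the empty one, whose entropy term is 0. So
  the sum may run over all words, the set on which product distributions live.\<close>

lemma partition_entropy_common_refinement_vimage:
  assumes \<xi>: "finite_measurable_partition M \<xi>" and S: "\<And>k. k \<in> I \<Longrightarrow> S k \<in> space M \<rightarrow> space M"
    and I: "finite I" "I \<noteq> {}"
  shows "partition_entropy M (common_refinement ((\<lambda>k. (\<lambda>C. S k -` C \<inter> space M) ` \<xi>) ` I))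
           = (\<Sum>w\<in>I \<rightarrow>\<^sub>E \<xi>. entropy_fun (measure M (name_cell M S I w)))"
proof -
  have fin: "finite (I \<rightarrow>\<^sub>E \<xi>)" and P: "partition_on (space M) \<xi>"
    using \<xi> I by (auto simp: finite_measurable_partition_def intro: finite_PiE)
  let ?g = "\<lambda>X. entropy_fun (measure M X)"
  have "partition_entropy M (common_refinement ((\<lambda>k. (\<lambda>C. S k -` C \<inter> space M) ` \<xi>) ` I))
      = sum ?g (name_cell M S I ` (I \<rightarrow>\<^sub>E \<xi>) - {{}})"
    using common_refinement_vimage_eq_name_cells[OF P S I(2)] by (simp add: partition_entropy_def)
  also have "\<dots> = sum ?g (name_cell M S I ` (I \<rightarrow>\<^sub>E \<xi>))"
    using fin by (intro sum.mono_neutral_left) (auto simp: entropy_fun_def)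
  also have "\<dots> = sum (?g \<circ> name_cell M S I) (I \<rightarrow>\<^sub>E \<xi>)"
  proof (rule sum.reindex_nontrivial[OF fin])
    fix w w' assume "w \<in> I \<rightarrow>\<^sub>E \<xi>" "w' \<in> I \<rightarrow>\<^sub>E \<xi>" "w \<noteq> w'" "name_cell M S I w = name_cell M S I w'"
    then have "name_cell M S I w = {}"
      using name_cell_unique[OF P] by (metis all_not_in_conv)
    then show "?g (name_cell M S I w) = 0" by (simp add: entropy_fun_def)
  qed
  finally show ?thesis by (simp add: o_def)
qed

text \<open>Pointwise Gibbs inequality: \<open>ln x \<le> x - 1\<close> at x = q / p. The correction
  q - p is kept because the total mass of M need not be 1, so it does not cancel on
  summation.\<close>

lemma entropy_fun_le:
  assumes "p \<ge> 0" "q > 0"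
  shows "entropy_fun p \<le> p * - ln q + (q - p)"
proof (cases "p = 0")
  case False
  then have "p * ln (q / p) \<le> p * (q / p - 1)"
    using assms by (intro mult_left_mono ln_le_minus_one) auto
  with False assms show ?thesis
    by (simp add: entropy_fun_def ln_div algebra_simps)
qed (use assms in \<open>simp add: entropy_fun_def\<close>)

text \<open>Gibbs' inequality against the average over \<open>u \<in> U\<close> of product distributions, where the
  letter at place \<open>k\<close> equals \<open>\<Phi> u k\<close> with probability \<open>1 - \<delta>\<close> and is otherwise uniform.\<close>

lemma entropy_le_code:
  fixes \<Phi> :: "'u \<Rightarrow> 'i \<Rightarrow> 'a set"
  assumes fM: "finite_measure M" and \<xi>: "finite_measurable_partition M \<xi>"
    and S: "\<And>k. k \<in> I \<Longrightarrow> S k \<in> measurable M M"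
    and mp: "\<And>k A. k \<in> I \<Longrightarrow> A \<in> sets M \<Longrightarrow> measure M (S k -` A \<inter> space M) = measure M A"
    and I: "finite I" "I \<noteq> {}" and U: "finite U" "U \<noteq> {}"
    and \<Phi>: "\<And>u k. u \<in> U \<Longrightarrow> k \<in> I \<Longrightarrow> \<Phi> u k \<in> \<xi>"
    and E: "E \<in> sets M"
    and code: "AE x in M. \<exists>u\<in>U. \<forall>k\<in>I. S k x \<in> \<Phi> u k \<or> S k x \<in> E"
    and \<delta>: "0 < \<delta>" "\<delta> < 1"
  shows "partition_entropy M (common_refinement ((\<lambda>k. (\<lambda>C. S k -` C \<inter> space M) ` \<xi>) ` I))
          \<le> 1 + measure M (space M) * (ln (real (card U)) + real (card I) * - ln (1 - \<delta>))
            + real (card I) * measure M E * ln (real (card \<xi>) / \<delta>)"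
proof -
  interpret finite_measure M by (rule fM)
  have P: "partition_on (space M) \<xi>" and fin\<xi>: "finite \<xi>" and \<xi>m: "\<And>C. C \<in> \<xi> \<Longrightarrow> C \<in> sets M"
    using \<xi> by (auto simp: finite_measurable_partition_def)
  have Ssp: "S k \<in> space M \<rightarrow> space M" if "k \<in> I" for k
    using S[OF that] by (auto simp: measurable_def)
  have "\<xi> \<noteq> {}" using U I \<Phi> by blast
  then have c0: "card \<xi> > 0" using fin\<xi> by (simp add: card_gt_0_iff)
  define W where "W = (I \<rightarrow>\<^sub>E \<xi>)"
  have finW: "finite W" unfolding W_def using I fin\<xi> by (intro finite_PiE) auto
  define r where "r = (\<lambda>c d :: 'a set. (if c = d then 1 - \<delta> else 0) + \<delta> / real (card \<xi>))"
  have r0: "r c d > 0" for c d using \<delta> c0 by (auto simp: r_def intro!: add_nonneg_pos)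
  have rsum: "(\<Sum>c\<in>\<xi>. r c d) = 1" if "d \<in> \<xi>" for d
    using that fin\<xi> c0 by (auto simp: r_def sum.distrib)
  define q where "q = (\<lambda>w. (1 / real (card U)) * (\<Sum>u\<in>U. \<Prod>k\<in>I. r (w k) (\<Phi> u k)))"
  have cU: "card U > 0" using U by (simp add: card_gt_0_iff)
  have q0: "q w > 0" for w
    unfolding q_def using U cU by (intro mult_pos_pos sum_pos prod_pos) (auto simp: r0)
  have qsum: "(\<Sum>w\<in>W. q w) = 1"
  proof -
    have "(\<Sum>w\<in>W. q w) = (1 / real (card U)) * (\<Sum>u\<in>U. \<Sum>w\<in>W. \<Prod>k\<in>I. r (w k) (\<Phi> u k))"
      unfolding q_def sum_distrib_left[symmetric] by (subst sum.swap) simp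
    also have "(\<Sum>u\<in>U. \<Sum>w\<in>W. \<Prod>k\<in>I. r (w k) (\<Phi> u k)) = (\<Sum>u\<in>U. \<Prod>k\<in>I. \<Sum>c\<in>\<xi>. r c (\<Phi> u k))"
      unfolding W_def using I fin\<xi> by (intro sum.cong refl prod_sum_PiE[symmetric]) auto
    also have "\<dots> = (\<Sum>u\<in>U. 1)"
      using \<Phi> rsum by (intro sum.cong refl prod.neutral) auto
    finally show ?thesis using cU by simp
  qed
  define N where "N = name_cell M S I"
  have Nm[measurable]: "N w \<in> sets M" if "w \<in> W" for w
  proof -
    have "N w = (\<Inter>k\<in>I. S k -` w k \<inter> space M)"
      using I by (auto simp: N_def name_cell_def)
    moreover have "S k -` w k \<inter> space M \<in> sets M" if "k \<in> I" for k
      using S[OF that] \<xi>m \<open>w \<in> W\<close> that by (intro measurable_sets) (auto simp: W_def)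
    ultimately show ?thesis using I by (simp only: sets.finite_INT not_False_eq_True)
  qed
  \<comment> \<open>b is the price of a correctly predicted letter. A letter seen while in E may
    cost l; charging b there as well puts both cases into the single expression b + l *
    indicator.\<close>
  define b where "b = - ln (1 - \<delta>)"
  define l where "l = ln (real (card \<xi>) / \<delta>)"
  have b0: "b \<ge> 0" using \<delta> by (simp add: b_def)
  have l0: "l \<ge> 0" unfolding l_def using \<delta> c0 by (intro ln_ge_zero) (simp add: field_simps)
  have rE: "- ln (r c d) \<le> b + l" for c d
  proof -
    have "ln (\<delta> / real (card \<xi>)) \<le> ln (r c d)"
      using \<delta> c0 r0[of c d] by (subst ln_le_cancel_iff) (auto simp: r_def)
    then show ?thesis using b0 \<delta> c0 by (simp add: l_def ln_div)
  qed
  have rD: "- ln (r c c) \<le> b" for c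
  proof -
    have "ln (1 - \<delta>) \<le> ln (r c c)"
      using \<delta> c0 r0[of c c] by (subst ln_le_cancel_iff) (auto simp: r_def)
    then show ?thesis by (simp add: b_def)
  qed
  let ?J = "\<lambda>k x. indicator (S k -` E \<inter> space M) x :: real"
  \<comment> \<open>Of the average q only the summand of the code u of the point x is retained. Its
    weight 1 / card U is the whole price for u depending on x.\<close>
  have key: "- ln (q w) \<le> ln (card U) + (\<Sum>k\<in>I. b + l * ?J k x)"
    if w: "w \<in> W" and x: "x \<in> N w" and u: "u \<in> U" and k: "\<forall>k\<in>I. S k x \<in> \<Phi> u k \<or> S k x \<in> E" for w x u
  proof -
    have "(\<Prod>k\<in>I. r (w k) (\<Phi> u k)) \<le> (\<Sum>u\<in>U. \<Prod>k\<in>I. r (w k) (\<Phi> u k))"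
      using U u r0 by (intro member_le_sum prod_nonneg) (auto intro: less_imp_le)
    then have "(1 / real (card U)) * (\<Prod>k\<in>I. r (w k) (\<Phi> u k)) \<le> q w"
      unfolding q_def by (intro mult_left_mono) auto
    moreover have pos: "(\<Prod>k\<in>I. r (w k) (\<Phi> u k)) > 0" using r0 by (intro prod_pos) auto
    ultimately have "ln ((1 / real (card U)) * (\<Prod>k\<in>I. r (w k) (\<Phi> u k))) \<le> ln (q w)"
      using q0[of w] cU by (subst ln_le_cancel_iff) auto
    also have "ln ((1 / real (card U)) * (\<Prod>k\<in>I. r (w k) (\<Phi> u k)))
        = - ln (card U) + (\<Sum>k\<in>I. ln (r (w k) (\<Phi> u k)))"
      using pos cU r0 r0[THEN less_imp_neq, THEN not_sym] I by (simp add: ln_mult ln_div ln_prod)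
    finally have "- ln (q w) \<le> ln (card U) + (\<Sum>k\<in>I. - ln (r (w k) (\<Phi> u k)))"
      by (simp add: sum_negf)
    also have "(\<Sum>k\<in>I. - ln (r (w k) (\<Phi> u k))) \<le> (\<Sum>k\<in>I. b + l * ?J k x)"
    proof (rule sum_mono)
      fix j assume j: "j \<in> I"
      have xs: "x \<in> space M" and xw: "S j x \<in> w j" using x j by (auto simp: N_def name_cell_def)
      show "- ln (r (w j) (\<Phi> u j)) \<le> b + l * ?J j x"
      proof (cases "S j x \<in> E")
        case True then show ?thesis using xs rE by simp
      next
        case False
        then have "S j x \<in> \<Phi> u j" using k j by blast
        then have "\<Phi> u j = w j"
          using xw \<Phi>[OF u j] w j by (intro partition_on_unique[OF P]) (auto simp: W_def)
        then show ?thesis using False rD by simp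
      qed
    qed
    finally show ?thesis by simp
  qed
  have Jm: "S k -` E \<inter> space M \<in> sets M" if "k \<in> I" for k
    using S[OF that] E by (rule measurable_sets)
  let ?R = "\<lambda>x. ln (card U) + (\<Sum>k\<in>I. b + l * ?J k x)"
  have intJ: "integrable M (?J k)" if "k \<in> I" for k
    using Jm[OF that] by (intro integrable_real_indicator) (auto simp: emeasure_eq_measure)
  have intR: "integrable M ?R"
    using intJ by (intro Bochner_Integration.integrable_add Bochner_Integration.integrable_sum
        integrable_mult_right integrable_const) auto
  \<comment> \<open>The integrand is - ln q of the word of x, so \<open>key\<close> can be
    integrated. Invariance then turns the visits to E into
    \<open>card I * measure M E\<close>.\<close>
  have "(\<Sum>w\<in>W. measure M (N w) * - ln (q w)) = (\<integral>x. (\<Sum>w\<in>W. indicator (N w) x * - ln (q w)) \<partial>M)"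
    using Nm by (subst Bochner_Integration.integral_sum)
      (auto intro!: sum.cong integrable_real_indicator simp: emeasure_eq_measure)
  also have "\<dots> \<le> (\<integral>x. ?R x \<partial>M)"
  proof (rule integral_mono_AE[OF _ intR])
    show "integrable M (\<lambda>x. \<Sum>w\<in>W. indicator (N w) x * - ln (q w))"
      using Nm by (intro Bochner_Integration.integrable_sum integrable_mult_left integrable_real_indicator)
        (auto simp: emeasure_eq_measure)
    have "AE x in M. x \<in> space M" by simp
    with code show "AE x in M. (\<Sum>w\<in>W. indicator (N w) x * - ln (q w)) \<le> ?R x"
    proof eventually_elim
      case (elim x)
      then obtain u where u: "u \<in> U" "\<forall>k\<in>I. S k x \<in> \<Phi> u k \<or> S k x \<in> E" by blast
      have "\<forall>k\<in>I. \<exists>C\<in>\<xi>. S k x \<in> C"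
      proof
        fix k assume "k \<in> I"
        then have "S k x \<in> \<Union>\<xi>"
          using funcset_mem[OF Ssp elim(2)] partition_onD1[OF P] by simp
        then show "\<exists>C\<in>\<xi>. S k x \<in> C" by blast
      qed
      then obtain w where w: "\<forall>k\<in>I. w k \<in> \<xi> \<and> S k x \<in> w k" by metis
      define w' where "w' = restrict w I"
      have w': "w' \<in> W" "x \<in> N w'"
        using w elim(2) by (auto simp: W_def w'_def N_def name_cell_def)
      have "indicator (N v) x * - ln (q v) = (if v = w' then - ln (q w') else 0)" if "v \<in> W" for v
      proof (cases "x \<in> N v")
        case True
        then have "v = w'"
          using that w' unfolding W_def N_def by (intro name_cell_unique[OF P])
        then show ?thesis using True by simp
      next
        case False
        then show ?thesis using w' by auto
      qed
      then have "(\<Sum>v\<in>W. indicator (N v) x * - ln (q v)) = (\<Sum>v\<in>W. if v = w' then - ln (q w') else 0)"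
        by (intro sum.cong) auto
      also have "\<dots> = - ln (q w')" using w' finW by simp
      also have "\<dots> \<le> ?R x" using key[OF w' u] .
      finally show ?case .
    qed
  qed
  also have "(\<integral>x. ?R x \<partial>M) = measure M (space M) * ln (card U) + (\<Sum>k\<in>I. measure M (space M) * b + l * measure M (S k -` E \<inter> space M))"
  proof -
    have "(\<integral>x. ?R x \<partial>M) = (\<integral>x. ln (card U) \<partial>M) + (\<Sum>k\<in>I. (\<integral>x. b + l * ?J k x \<partial>M))"
      using intJ by (subst Bochner_Integration.integral_add) (auto intro!: Bochner_Integration.integrable_sum)
    also have "(\<Sum>k\<in>I. (\<integral>x. b + l * ?J k x \<partial>M)) = (\<Sum>k\<in>I. measure M (space M) * b + l * measure M (S k -` E \<inter> space M))"
      using intJ Jm by (intro sum.cong refl) (simp add: Int_absorb2 sets.sets_into_space)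
    finally show ?thesis by simp
  qed
  also have "\<dots> = measure M (space M) * (ln (card U) + card I * b) + card I * measure M E * l"
    using mp E by (simp add: algebra_simps)
  finally have A: "(\<Sum>w\<in>W. measure M (N w) * - ln (q w)) \<le> \<dots>" .
  have "(\<Sum>w\<in>W. entropy_fun (measure M (N w))) \<le> (\<Sum>w\<in>W. measure M (N w) * - ln (q w) + (q w - measure M (N w)))"
    using q0 by (intro sum_mono entropy_fun_le) auto
  \<comment> \<open>The corrections q - p sum to 1 minus a nonnegative mass; this is the origin of
    the summand 1 in the bound.\<close>
  also have "\<dots> \<le> (\<Sum>w\<in>W. measure M (N w) * - ln (q w)) + 1"
    unfolding sum.distrib sum_subtractf qsum by (simp add: sum_nonneg)
  finally have B: "(\<Sum>w\<in>W. entropy_fun (measure M (N w))) \<le> \<dots>" .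
  show ?thesis
    using A B partition_entropy_common_refinement_vimage[OF \<xi> Ssp I] by (simp add: W_def N_def b_def l_def)
qed


subsection \<open>Choice of the tower height\<close>

lemma ln_Suc_le:
  assumes "h \<ge> 1"
  shows "ln (real h + 1) \<le> ln 2 + ln (real h)"
proof -
  have "ln (real h + 1) \<le> ln (2 * real h)"
    using assms by (subst ln_le_cancel_iff) auto
  also have "\<dots> = ln 2 + ln (real h)" using assms by (subst ln_mult) auto
  finally show ?thesis .
qed

lemma limsup_less_top_imp_eventually_le:
  fixes f :: "nat \<Rightarrow> real"
  assumes "limsup (\<lambda>n. ereal (f n)) < \<infinity>"
  obtains K where "K > 0" "\<forall>\<^sub>F n in sequentially. f n \<le> K"
proof -
  obtain c where c: "limsup (\<lambda>n. ereal (f n)) < ereal c"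
    using assms less_PInf_Ex_of_nat by auto
  then have "\<forall>\<^sub>F n in sequentially. ereal (f n) < ereal c"
    by (rule Limsup_lessD)
  then have "\<forall>\<^sub>F n in sequentially. f n \<le> max c 1"
    by eventually_elim auto
  then show thesis using that[of "max c 1"] by auto
qed

text \<open>The left side bounds the logarithm of the number
  \<open>(h m + 1) ^ (t n div h m + 2)\<close> of codes. The level m may vary with n but has to
  exceed any prescribed N, since only late towers resolve a given partition up to a small
  set.\<close>

definition slow_coding :: "(nat \<Rightarrow> nat) \<Rightarrow> (nat \<Rightarrow> nat) \<Rightarrow> bool" where
  "slow_coding t h \<longleftrightarrow> (\<forall>\<epsilon>>0. \<forall>N. \<forall>\<^sub>F n in sequentially.
     \<exists>m\<ge>N. (real (t n) / real (h m) + 2) * ln (real (h m) + 1) \<le> \<epsilon> * real n)"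

text \<open>Take \<open>m\<close> with \<open>h m \<le> t n < h (Suc m)\<close>; the level \<open>Suc m\<close> works unless \<open>h (Suc m)\<close> is
  exponentially large in \<open>n\<close>, and then the growth condition makes \<open>h m\<close> large.\<close>

lemma slow_codingI:
  assumes h1: "h 1 \<ge> 1" and hmono: "\<forall>m\<ge>1. h m < h (Suc m)"
    and tt: "filterlim t at_top sequentially"
    and main: "\<And>\<epsilon>. \<epsilon> > 0 \<Longrightarrow> \<forall>\<^sub>F n in sequentially. \<forall>m\<ge>k. 1 \<le> h m \<longrightarrow> h m \<le> t n
        \<longrightarrow> \<epsilon> * real n < ln (real (h (Suc m)))
        \<longrightarrow> (real (t n) / real (h m) + 2) * ln (real (h m) + 1) \<le> \<epsilon> * real n"
  shows "slow_coding t h"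
  unfolding slow_coding_def
proof (intro allI impI)
  fix \<epsilon> :: real and N assume \<epsilon>: "\<epsilon> > 0"
  define L where "L = max 1 (max N k)"
  have hpos: "h m \<ge> 1" if "m \<ge> 1" for m
    using that by (induction m rule: dec_induct) (use h1 hmono in \<open>auto intro: le_trans less_imp_le\<close>)
  have hge: "h m \<ge> m" if "m \<ge> 1" for m
    using that by (induction m rule: dec_induct) (use h1 hmono in \<open>auto simp: Suc_le_eq intro: le_less_trans\<close>)
  \<comment> \<open>At level \<open>Suc m\<close> the first factor is at most 3, as
    \<open>t n < h (Suc m)\<close>. With \<epsilon>/4 in place of \<epsilon> the product is at most
    3 (ln 2 + \<epsilon>/4 n), leaving a quarter of \<epsilon> n to absorb the constant.\<close>
  have "\<epsilon> / 4 > 0" using \<epsilon> by simp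
  note main[OF this]
  moreover have "\<forall>\<^sub>F n in sequentially. t n \<ge> h L"
    using tt by (auto simp: filterlim_at_top)
  moreover have "\<forall>\<^sub>F n in sequentially. 3 * (ln 2 + \<epsilon> / 4 * real n) \<le> \<epsilon> * real n"
    using \<epsilon> by real_asymp
  ultimately show "\<forall>\<^sub>F n in sequentially.
     \<exists>m\<ge>N. (real (t n) / real (h m) + 2) * ln (real (h m) + 1) \<le> \<epsilon> * real n"
  proof eventually_elim
    case (elim n)
    define m where "m = (GREATEST m. m \<ge> L \<and> h m \<le> t n)"
    have bd: "\<forall>y. y \<ge> L \<and> h y \<le> t n \<longrightarrow> y \<le> t n"
      using hge by (auto simp: L_def intro: le_trans)
    have m: "m \<ge> L \<and> h m \<le> t n"
      unfolding m_def by (rule GreatestI_nat[where k=L and b="t n"]) (use elim bd in auto)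
    have m': "t n < h (Suc m)"
    proof (rule ccontr)
      assume "\<not> t n < h (Suc m)"
      then have "Suc m \<le> m"
        unfolding m_def using bd m by (intro Greatest_le_nat[where b="t n"]) (auto simp: m_def)
      then show False by simp
    qed
    have h1m: "h m \<ge> 1" "h (Suc m) \<ge> 1" using m hpos by (auto simp: L_def)
    show ?case
    proof (cases "\<epsilon> / 4 * real n < ln (real (h (Suc m)))")
      case True
      then have "(real (t n) / real (h m) + 2) * ln (real (h m) + 1) \<le> \<epsilon> / 4 * real n"
        using elim(1) m h1m by (auto simp: L_def)
      also have "\<dots> \<le> \<epsilon> * real n"
        using \<epsilon> by (intro mult_right_mono) auto
      finally show ?thesis using m by (auto simp: L_def)
    next
      case False
      have "(real (t n) / real (h (Suc m)) + 2) * ln (real (h (Suc m)) + 1) \<le> 3 * (ln 2 + \<epsilon> / 4 * real n)"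
        using m' h1m False ln_Suc_le[of "h (Suc m)"]
        by (intro mult_mono) (auto simp: field_simps)
      then show ?thesis using m elim(3) by (intro exI[of _ "Suc m"]) (auto simp: L_def)
    qed
  qed
qed

section \<open>Heights under the three growth conditions\<close>

lemma strict_mono_on_atLeast_1_ge:
  fixes t :: "nat \<Rightarrow> nat"
  assumes "strict_mono_on {1..} t" "n \<ge> 1"
  shows "t n \<ge> n - 1"
  using assms(2)
proof (induction n rule: dec_induct)
  case (step n)
  then have "t n < t (Suc n)" using assms(1) by (auto simp: strict_mono_on_def)
  with step show ?case by linarith
qed auto

lemma strict_mono_on_atLeast_1_at_top:
  fixes t :: "nat \<Rightarrow> nat"
  assumes "strict_mono_on {1..} t"
  shows "filterlim t at_top sequentially"
proof (rule filterlim_at_top_mono)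
  show "filterlim (\<lambda>n::nat. n - 1) at_top sequentially" by real_asymp
  show "\<forall>\<^sub>F n in sequentially. n - 1 \<le> t n"
    using eventually_ge_at_top[of 1] by eventually_elim (rule strict_mono_on_atLeast_1_ge[OF assms])
qed

text \<open>From h m \<le> t n follows \<open>ln (h (Suc m)) \<le> K * ln (t n)\<close>, which is
  o(n). So the exponentially large case of \<open>slow_codingI\<close> does not occur for large
  n.\<close>

lemma slow_coding_subexponential:
  assumes h: "h 1 \<ge> 1" "\<forall>m\<ge>1. h m < h (Suc m)"
    and t: "strict_mono_on {1..} t" "subexponential t"
    and gr: "limsup (\<lambda>n. ereal (ln (real (h (Suc n))) / ln (real (h n)))) < \<infinity>"
  shows "slow_coding t h"
proof -
  obtain K where K: "K > 0" "\<forall>\<^sub>F n in sequentially. ln (real (h (Suc n))) / ln (real (h n)) \<le> K"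
    using gr by (rule limsup_less_top_imp_eventually_le)
  then obtain N1 where N1: "\<And>n. n \<ge> N1 \<Longrightarrow> ln (real (h (Suc n))) / ln (real (h n)) \<le> K"
    by (auto simp: eventually_sequentially)
  \<comment> \<open>This makes \<open>ln (h m)\<close> positive, so that the bound on the quotient
    can be multiplied out; \<open>h 1\<close> may be 1.\<close>
  have h2: "h m \<ge> 2" if "m \<ge> 2" for m
    using that
  proof (induction m rule: dec_induct)
    case base then show ?case using h(1) spec[OF h(2), of 1] by (simp add: numeral_2_eq_2)
  next
    case (step m) then show ?case using spec[OF h(2), of m] by simp
  qed
  show ?thesis
  proof (rule slow_codingI[OF h strict_mono_on_atLeast_1_at_top[OF t(1)], where k = "max 2 N1"])
    fix \<epsilon> :: real assume \<epsilon>: "\<epsilon> > 0"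
    have "\<forall>\<^sub>F n in sequentially. ln (real (t n)) / real n < \<epsilon> / K"
      using t(2) \<epsilon> K unfolding subexponential_def by (intro order_tendstoD(2)) auto
    then show "\<forall>\<^sub>F n in sequentially. \<forall>m\<ge>max 2 N1. 1 \<le> h m \<longrightarrow> h m \<le> t n
        \<longrightarrow> \<epsilon> * real n < ln (real (h (Suc m)))
        \<longrightarrow> (real (t n) / real (h m) + 2) * ln (real (h m) + 1) \<le> \<epsilon> * real n"
      using eventually_gt_at_top[of 0]
    proof eventually_elim
      case (elim n)
      have "ln (real (h (Suc m))) \<le> \<epsilon> * real n" if m: "m \<ge> max 2 N1" "h m \<le> t n" for m
      proof -
        have "h m \<ge> 2" using m h2 by auto
        then have "ln (real (h (Suc m))) \<le> K * ln (real (h m))"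
          using N1[of m] m by (simp add: field_simps)
        also have "\<dots> \<le> K * ln (real (t n))"
          using K m \<open>h m \<ge> 2\<close> by (intro mult_left_mono) auto
        also have "\<dots> \<le> \<epsilon> * real n"
          using elim K by (simp add: field_simps)
        finally show ?thesis .
      qed
      then show ?case by fastforce
    qed
  qed
qed

text \<open>Under the growth conditions of (ii) and (iii), \<open>h (Suc m)\<close> exponentially large in \<open>n\<close>
  forces \<open>h m \<ge> g n\<close>; the exponent \<open>\<eta> > 0\<close> absorbs the logarithm of \<open>h m\<close>.\<close>

lemma code_length_le:
  assumes h: "1 \<le> h" "h \<le> t" and g: "0 < g" "g \<le> real h" and \<eta>: "0 < \<eta>" "\<eta> < 1"
  shows "(real t / real h + 2) * ln (real h + 1)
           \<le> real t * (2 powr \<eta> / \<eta> * g powr (\<eta> - 1)) + 2 * ln (real t + 1)"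
proof -
  \<comment> \<open>The logarithm is traded for a small power: ln x \<le> x^\<eta> / \<eta>.
    Division by h leaves the exponent \<eta> - 1 < 0, for which h may be replaced by its lower bound
    g.\<close>
  have "ln (real h + 1) = ln ((real h + 1) powr \<eta>) / \<eta>"
    using \<eta> h by (simp add: ln_powr)
  also have "\<dots> \<le> (real h + 1) powr \<eta> / \<eta>"
    using \<eta> h by (intro divide_right_mono order.trans[OF ln_le_minus_one]) auto
  also have "\<dots> \<le> (2 * real h) powr \<eta> / \<eta>"
    using \<eta> h by (intro divide_right_mono powr_mono2) auto
  also have "\<dots> = 2 powr \<eta> / \<eta> * real h powr \<eta>"
    using h by (simp add: powr_mult)
  finally have "real t / real h * ln (real h + 1) \<le> real t / real h * (2 powr \<eta> / \<eta> * real h powr \<eta>)"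
    by (intro mult_left_mono) auto
  also have "\<dots> = real t * (2 powr \<eta> / \<eta> * real h powr (\<eta> - 1))"
    using h by (simp add: powr_diff)
  also have "\<dots> \<le> real t * (2 powr \<eta> / \<eta> * g powr (\<eta> - 1))"
    using g \<eta> by (intro mult_left_mono powr_mono2') auto
  finally have "real t / real h * ln (real h + 1) \<le> \<dots>" .
  moreover have "ln (real h + 1) \<le> ln (real t + 1)" using h by simp
  ultimately show ?thesis unfolding distrib_right by linarith
qed

text \<open>If \<open>ln (h (Suc m))\<close> exceeds \<epsilon> n, the growth condition gives h m
  \<ge> (\<epsilon> n / K)^(1/\<beta>). With \<open>t n\<close> at most c n^\<alpha> the code length
  is then of order n^(\<alpha> + (\<eta> - 1)/\<beta>), plus a logarithmic term.\<close>

lemma slow_coding_power: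
  fixes \<alpha> \<beta> :: real
  assumes h: "h 1 \<ge> 1" "\<forall>m\<ge>1. h m < h (Suc m)"
    and t: "strict_mono_on {1..} t" "(\<lambda>n. real (t n)) \<in> O(\<lambda>n. real n powr \<alpha>)"
    and \<alpha>: "\<alpha> > 1" and \<beta>: "\<beta> > 0" "\<beta> < 1 / (\<alpha> - 1)"
    and gr: "limsup (\<lambda>n. ereal (ln (real (h (Suc n))) / real (h n) powr \<beta>)) < \<infinity>"
  shows "slow_coding t h"
proof -
  obtain K where K: "K > 0" "\<forall>\<^sub>F n in sequentially. ln (real (h (Suc n))) / real (h n) powr \<beta> \<le> K"
    using gr by (rule limsup_less_top_imp_eventually_le)
  then obtain N1 where N1: "\<And>n. n \<ge> N1 \<Longrightarrow> ln (real (h (Suc n))) / real (h n) powr \<beta> \<le> K"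
    by (auto simp: eventually_sequentially)
  obtain c where c: "c > 0" "\<forall>\<^sub>F n in sequentially. norm (real (t n)) \<le> c * norm (real n powr \<alpha>)"
    using t(2) by (auto elim: landau_o.bigE)
  \<comment> \<open>Half of the slack in (\<alpha> - 1) \<beta> < 1: the exponent \<alpha> + (\<eta>
    - 1)/\<beta> becomes 1 - \<eta>/\<beta>.\<close>
  define \<eta> where "\<eta> = (1 - (\<alpha> - 1) * \<beta>) / 2"
  have ab: "(\<alpha> - 1) * \<beta> < 1" "(\<alpha> - 1) * \<beta> > 0" using \<alpha> \<beta> by (auto simp: field_simps)
  have \<eta>: "0 < \<eta>" "\<eta> < 1" using ab by (auto simp: \<eta>_def)
  have ex: "\<alpha> + (\<eta> - 1) / \<beta> < 1"
  proof -
    have "(\<alpha> - 1) * \<beta> + (\<eta> - 1) < 0" using ab unfolding \<eta>_def by argo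
    then have "((\<alpha> - 1) * \<beta> + (\<eta> - 1)) / \<beta> < 0" using \<beta> by (simp add: divide_neg_pos)
    then show ?thesis using \<beta> by (simp add: add_divide_distrib)
  qed
  show ?thesis
  proof (rule slow_codingI[OF h strict_mono_on_atLeast_1_at_top[OF t(1)], where k = N1])
    fix \<epsilon> :: real assume \<epsilon>: "\<epsilon> > 0"
    define B where "B = c * (2 powr \<eta> / \<eta>) * (\<epsilon> / K) powr ((\<eta> - 1) / \<beta>)"
    have "\<forall>\<^sub>F n in sequentially. B * real n powr (\<alpha> + (\<eta> - 1) / \<beta>)
            + 2 * ln (c * real n powr \<alpha> + 1) \<le> \<epsilon> * real n"
    proof -
      define p where "p = \<alpha> + (\<eta> - 1) / \<beta>"
      have "p < 1" using ex by (simp add: p_def)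
      then have "(\<lambda>n. B * real n powr p / real n) \<longlonglongrightarrow> 0" by real_asymp
      moreover have "(\<lambda>n. 2 * ln (c * real n powr \<alpha> + 1) / real n) \<longlonglongrightarrow> 0"
        using \<alpha> c by real_asymp
      ultimately have "(\<lambda>n. B * real n powr p / real n + 2 * ln (c * real n powr \<alpha> + 1) / real n) \<longlonglongrightarrow> 0"
        by (rule tendsto_add_zero)
      then have "\<forall>\<^sub>F n in sequentially. B * real n powr p / real n + 2 * ln (c * real n powr \<alpha> + 1) / real n < \<epsilon>"
        using \<epsilon> by (rule order_tendstoD)
      then show ?thesis using eventually_gt_at_top[of 0]
        unfolding p_def by eventually_elim (auto simp: field_simps)
    qed
    then show "\<forall>\<^sub>F n in sequentially. \<forall>m\<ge>N1. 1 \<le> h m \<longrightarrow> h m \<le> t n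
        \<longrightarrow> \<epsilon> * real n < ln (real (h (Suc m)))
        \<longrightarrow> (real (t n) / real (h m) + 2) * ln (real (h m) + 1) \<le> \<epsilon> * real n"
      using c(2) eventually_gt_at_top[of 0]
    proof eventually_elim
      case (elim n)
      show ?case
      proof (intro allI impI)
        fix m assume m: "N1 \<le> m" "1 \<le> h m" "h m \<le> t n" "\<epsilon> * real n < ln (real (h (Suc m)))"
        define g where "g = (\<epsilon> / K * real n) powr (1 / \<beta>)"
        have "\<epsilon> / K * real n \<le> real (h m) powr \<beta>"
          using N1[OF m(1)] m K by (simp add: field_simps)
        then have "g \<le> (real (h m) powr \<beta>) powr (1 / \<beta>)"
          unfolding g_def using \<epsilon> K \<beta> by (intro powr_mono2) auto
        then have g: "g \<le> real (h m)" using \<beta> m by (simp add: powr_powr)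
        have g0: "g > 0" using \<epsilon> K elim(3) by (simp add: g_def)
        have tn: "real (t n) \<le> c * real n powr \<alpha>" using elim by simp
        have gp: "g powr (\<eta> - 1) = (\<epsilon> / K) powr ((\<eta> - 1) / \<beta>) * real n powr ((\<eta> - 1) / \<beta>)"
          unfolding g_def powr_powr using \<epsilon> K by (subst powr_mult) auto
        have "(real (t n) / real (h m) + 2) * ln (real (h m) + 1)
           \<le> real (t n) * (2 powr \<eta> / \<eta> * g powr (\<eta> - 1)) + 2 * ln (real (t n) + 1)"
          by (rule code_length_le[OF m(2,3) g0 g \<eta>])
        also have "\<dots> \<le> c * real n powr \<alpha> * (2 powr \<eta> / \<eta> * g powr (\<eta> - 1)) + 2 * ln (c * real n powr \<alpha> + 1)"
          using tn \<eta> c by (intro add_mono mult_right_mono mult_left_mono) (auto simp: add_nonneg_pos)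
        also have "\<dots> = B * real n powr (\<alpha> + (\<eta> - 1) / \<beta>) + 2 * ln (c * real n powr \<alpha> + 1)"
          unfolding gp B_def by (simp add: powr_add)
        also have "\<dots> \<le> \<epsilon> * real n" using elim by simp
        finally show "(real (t n) / real (h m) + 2) * ln (real (h m) + 1) \<le> \<epsilon> * real n" .
      qed
    qed
  qed
qed

text \<open>As for powers, but the growth condition now yields only h m \<ge> (ln (A n))^(1/\<beta>)
  with A = \<epsilon>/K. This suffices because \<open>t n\<close> exceeds n merely by a power of ln
  n, which the negative power of ln (A n) outweighs.\<close>

lemma slow_coding_n_log:
  fixes C \<alpha> \<beta> :: real
  assumes h: "h 1 \<ge> 1" "\<forall>m\<ge>1. h m < h (Suc m)"
    and C: "C > 0" and \<alpha>: "\<alpha> > 0" and \<beta>: "\<beta> > 0" "\<beta> < 1 / \<alpha>"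
    and gr: "limsup (\<lambda>n. ereal (ln (real (h (Suc n))) / exp (real (h n) powr \<beta>))) < \<infinity>"
  shows "slow_coding (\<lambda>n. nat \<lfloor>C * real n * ln (real n) powr \<alpha>\<rfloor>) h"
proof -
  define t where "t = (\<lambda>n. nat \<lfloor>C * real n * ln (real n) powr \<alpha>\<rfloor>)"
  obtain K where K: "K > 0" "\<forall>\<^sub>F n in sequentially. ln (real (h (Suc n))) / exp (real (h n) powr \<beta>) \<le> K"
    using gr by (rule limsup_less_top_imp_eventually_le)
  then obtain N1 where N1: "\<And>n. n \<ge> N1 \<Longrightarrow> ln (real (h (Suc n))) / exp (real (h n) powr \<beta>) \<le> K"
    by (auto simp: eventually_sequentially)
  have tt: "filterlim t at_top sequentially"
    unfolding t_def using C \<alpha> by real_asymp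
  \<comment> \<open>Again half of the slack: the exponent \<alpha> + (\<eta> - 1)/\<beta> of the
    logarithm becomes -\<eta>/\<beta>.\<close>
  define \<eta> where "\<eta> = (1 - \<alpha> * \<beta>) / 2"
  have ab: "\<alpha> * \<beta> < 1" "\<alpha> * \<beta> > 0" using \<alpha> \<beta> by (auto simp: field_simps)
  have \<eta>: "0 < \<eta>" "\<eta> < 1" using ab by (auto simp: \<eta>_def)
  have ex: "\<alpha> + (\<eta> - 1) / \<beta> < 0"
  proof -
    have "\<alpha> * \<beta> + (\<eta> - 1) < 0" using ab unfolding \<eta>_def by argo
    then have "(\<alpha> * \<beta> + (\<eta> - 1)) / \<beta> < 0" using \<beta> by (simp add: divide_neg_pos)
    then show ?thesis using \<beta> by (simp add: add_divide_distrib)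
  qed
  have "slow_coding t h"
  proof (rule slow_codingI[OF h tt, where k = N1])
    fix \<epsilon> :: real assume \<epsilon>: "\<epsilon> > 0"
    define A where "A = \<epsilon> / K"
    have A: "A > 0" using \<epsilon> K by (simp add: A_def)
    define B where "B = 2 powr \<eta> / \<eta>"
    define p where "p = (\<eta> - 1) / \<beta>"
    have lim: "\<forall>\<^sub>F n in sequentially. C * real n * ln (real n) powr \<alpha> * (B * ln (A * real n) powr p)
            + 2 * ln (C * real n * ln (real n) powr \<alpha> + 1) \<le> \<epsilon> * real n"
    proof -
      have "(\<lambda>n. ln (real n) powr \<alpha> * ln (A * real n) powr p) \<longlonglongrightarrow> 0"
      proof -
        have p: "\<alpha> + p < 0" using ex by (simp add: p_def)
        \<comment> \<open>Replacing ln (A n) by ln n costs a factor tending to 1, after which the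
          powers combine to the negative exponent \<alpha> + p.\<close>
        have "(\<lambda>n. ln (real n) powr (\<alpha> + p) * (ln (A * real n) / ln (real n)) powr p) \<longlonglongrightarrow> 0 * 1 powr p"
        proof (intro tendsto_mult tendsto_powr)
          show "(\<lambda>n. ln (real n) powr (\<alpha> + p)) \<longlonglongrightarrow> 0" using p by real_asymp
          show "(\<lambda>n. ln (A * real n) / ln (real n)) \<longlonglongrightarrow> 1" using A by real_asymp
        qed auto
        moreover have "\<forall>\<^sub>F n in sequentially. ln (A * real n) > 0" using A by real_asymp
        then have "\<forall>\<^sub>F n in sequentially. ln (real n) powr (\<alpha> + p) * (ln (A * real n) / ln (real n)) powr p
            = ln (real n) powr \<alpha> * ln (A * real n) powr p"
          using eventually_gt_at_top[of 1]
          by eventually_elim (auto simp: powr_add powr_divide)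
        ultimately show ?thesis by (auto elim: Lim_transform_eventually)
      qed
      then have "(\<lambda>n. C * B * (ln (real n) powr \<alpha> * ln (A * real n) powr p)) \<longlonglongrightarrow> 0"
        by (rule tendsto_mult_right_zero)
      moreover have "(\<lambda>n. 2 * ln (C * real n * ln (real n) powr \<alpha> + 1) / real n) \<longlonglongrightarrow> 0"
        using \<alpha> C by real_asymp
      ultimately have "(\<lambda>n. C * B * (ln (real n) powr \<alpha> * ln (A * real n) powr p)
          + 2 * ln (C * real n * ln (real n) powr \<alpha> + 1) / real n) \<longlonglongrightarrow> 0"
        by (rule tendsto_add_zero)
      then have "\<forall>\<^sub>F n in sequentially. C * B * (ln (real n) powr \<alpha> * ln (A * real n) powr p)
          + 2 * ln (C * real n * ln (real n) powr \<alpha> + 1) / real n < \<epsilon>"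
        using \<epsilon> by (rule order_tendstoD)
      then show ?thesis using eventually_gt_at_top[of 0]
        by eventually_elim (auto simp: field_simps)
    qed
    have "\<forall>\<^sub>F n in sequentially. ln (A * real n) > 0" using A by real_asymp
    with lim show "\<forall>\<^sub>F n in sequentially. \<forall>m\<ge>N1. 1 \<le> h m \<longrightarrow> h m \<le> t n
        \<longrightarrow> \<epsilon> * real n < ln (real (h (Suc m)))
        \<longrightarrow> (real (t n) / real (h m) + 2) * ln (real (h m) + 1) \<le> \<epsilon> * real n"
      using eventually_gt_at_top[of 0]
    proof eventually_elim
      case (elim n)
      show ?case
      proof (intro allI impI)
        fix m assume m: "N1 \<le> m" "1 \<le> h m" "h m \<le> t n" "\<epsilon> * real n < ln (real (h (Suc m)))"
        define g where "g = ln (A * real n) powr (1 / \<beta>)"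
        have "A * real n \<le> exp (real (h m) powr \<beta>)"
          using N1[OF m(1)] m K by (simp add: A_def field_simps)
        then have "ln (A * real n) \<le> ln (exp (real (h m) powr \<beta>))"
          using A elim(3) by (subst ln_le_cancel_iff) auto
        then have "g \<le> (real (h m) powr \<beta>) powr (1 / \<beta>)"
          unfolding g_def using \<beta> elim by (intro powr_mono2) auto
        then have g: "g \<le> real (h m)" using \<beta> m by (simp add: powr_powr)
        have g0: "g > 0" using elim by (simp add: g_def)
        have tn: "real (t n) \<le> C * real n * ln (real n) powr \<alpha>" using C by (simp add: t_def)
        have gp: "g powr (\<eta> - 1) = ln (A * real n) powr p"
          by (simp add: g_def p_def powr_powr)
        have "(real (t n) / real (h m) + 2) * ln (real (h m) + 1)
           \<le> real (t n) * (2 powr \<eta> / \<eta> * g powr (\<eta> - 1)) + 2 * ln (real (t n) + 1)"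
          by (rule code_length_le[OF m(2,3) g0 g \<eta>])
        also have "\<dots> \<le> C * real n * ln (real n) powr \<alpha> * (2 powr \<eta> / \<eta> * g powr (\<eta> - 1))
            + 2 * ln (C * real n * ln (real n) powr \<alpha> + 1)"
          using tn \<eta> C by (intro add_mono mult_right_mono mult_left_mono) (auto simp: add_nonneg_pos)
        also have "\<dots> \<le> \<epsilon> * real n" using elim by (simp add: gp B_def)
        finally show "(real (t n) / real (h m) + 2) * ln (real (h m) + 1) \<le> \<epsilon> * real n" .
      qed
    qed
  qed
  then show ?thesis by (simp add: t_def)
qed


subsection \<open>Coding orbits by towers\<close>

lemma invertible_measure_preserving_funpow:
  assumes T: "invertible_measure_preserving M T"
  shows "bij_betw (T ^^ k) (space M) (space M)"
    and "T ^^ k \<in> measurable M M"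
    and "A \<in> sets M \<Longrightarrow> emeasure M ((T ^^ k) -` A \<inter> space M) = emeasure M A"
    and "A \<in> sets M \<Longrightarrow> (T ^^ k) ` A \<in> sets M"
proof -
  have bij: "bij_betw T (space M) (space M)" and meas: "T \<in> measurable M M"
    and inv: "the_inv_into (space M) T \<in> measurable M M"
    and mp: "\<And>A. A \<in> sets M \<Longrightarrow> emeasure M (T -` A \<inter> space M) = emeasure M A"
    using T by (auto simp: invertible_measure_preserving_def)
  show bijk: "bij_betw (T ^^ k) (space M) (space M)" for k
  proof (induction k)
    case (Suc k)
    then show ?case using bij_betw_trans[OF Suc bij] by (simp only: funpow.simps)
  qed (auto simp: bij_betw_def)
  show meask: "T ^^ k \<in> measurable M M" for k
  proof (induction k)
    case (Suc k)
    then show ?case using measurable_comp[OF Suc meas] by (simp only: funpow.simps)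
  qed (auto simp: id_def)
  show "emeasure M ((T ^^ k) -` A \<inter> space M) = emeasure M A" if "A \<in> sets M"
    using that
  proof (induction k arbitrary: A)
    case (Suc k)
    have "(T ^^ Suc k) -` A \<inter> space M = (T ^^ k) -` (T -` A \<inter> space M) \<inter> space M"
      using bij_betwE[OF bijk[of k]] by auto
    then show ?case
      using Suc.IH[OF measurable_sets[OF meas Suc.prems]] mp[OF Suc.prems] by (simp only:)
  qed (simp add: sets.Int_space_eq2)
  have image: "T ` A \<in> sets M" if "A \<in> sets M" for A
  proof -
    have "A \<subseteq> space M" using that by (rule sets.sets_into_space)
    then have "T ` A = the_inv_into (space M) T -` A \<inter> space M"
      using bij by (auto simp: bij_betw_def the_inv_into_f_f image_iff)
        (metis f_the_inv_into_f)
    then show ?thesis using measurable_sets[OF inv that] by simp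
  qed
  show "(T ^^ k) ` A \<in> sets M" if "A \<in> sets M"
  proof (induction k)
    case (Suc k)
    have "(T ^^ Suc k) ` A = T ` (T ^^ k) ` A" by auto
    then show ?case using image[OF Suc] by simp
  qed (use that in simp)
qed

text \<open>M need not be complete, so a subset of a null set is null only once it is known to be
  measurable; hence the conditions on A and C.\<close>

lemma null_eq_trans:
  assumes "null_eq M A B" "null_eq M B C" "A \<in> sets M" "C \<in> sets M"
  shows "null_eq M A C"
  unfolding null_eq_def
proof (rule null_sets_subset)
  show "sym_diff A B \<union> sym_diff B C \<in> null_sets M"
    using assms by (auto simp: null_eq_def)
qed (use assms in auto)

lemma null_eq_UN:
  assumes "finite I" "\<And>i. i \<in> I \<Longrightarrow> null_eq M (A i) (B i)"
    "\<And>i. i \<in> I \<Longrightarrow> A i \<in> sets M" "\<And>i. i \<in> I \<Longrightarrow> B i \<in> sets M"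
  shows "null_eq M (\<Union>i\<in>I. A i) (\<Union>i\<in>I. B i)"
  unfolding null_eq_def
proof (rule null_sets_subset)
  show "(\<Union>i\<in>I. sym_diff (A i) (B i)) \<in> null_sets M"
    using assms by (intro null_sets_UN' countable_finite) (auto simp: null_eq_def)
qed (use assms in \<open>auto intro!: sets.Un sets.Diff sets.finite_UN\<close>)

lemma common_refinement_singleton:
  assumes "A \<noteq> {}"
  shows "common_refinement {{A}} = {A}"
proof -
  have "(\<Union>f\<in>(\<Pi> P\<in>{{A}}. P). {\<Inter> (f ` {{A}})}) = (\<Union>f\<in>(\<Pi> P\<in>{{A}}. P). {A})"
    by (rule SUP_cong) (auto simp: Pi_iff)
  also have "\<dots> = {A}"
    using assms by (subst UN_constant) auto
  finally show ?thesis using assms unfolding common_refinement by simp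
qed

section \<open>Towers and addresses\<close>

locale generating_towers = finite_measure M
  for M :: "'a measure" and T :: "'a \<Rightarrow> 'a" and F :: "nat \<Rightarrow> 'a set" and h :: "nat \<Rightarrow> nat" +
  assumes T: "invertible_measure_preserving M T"
    and F: "\<And>m. m \<ge> 1 \<Longrightarrow> F m \<in> sets M"
    and h_pos: "\<And>m. m \<ge> 1 \<Longrightarrow> h m \<ge> 1"
    and levels_disjoint: "\<And>m i j. m \<ge> 1 \<Longrightarrow> i < h m \<Longrightarrow> j < h m \<Longrightarrow> i \<noteq> j \<Longrightarrow>
           (T ^^ i) ` F m \<inter> (T ^^ j) ` F m \<in> null_sets M"
    and refining: "\<And>m A. m \<ge> 1 \<Longrightarrow> A \<in> tower_partition M T F h m \<Longrightarrow>
           \<exists>\<C>\<subseteq>tower_partition M T F h (Suc m). null_eq M A (\<Union>\<C>)"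
    and generating: "\<And>A. A \<in> sets M \<Longrightarrow>
           \<exists>B\<in>sigma_sets (space M) (\<Union>m\<in>{1..}. tower_partition M T F h m). null_eq M A B"
begin

text \<open>As the levels are disjoint only modulo null sets, a point may lie on several levels;
  recording the set of all of them makes the cells with equal address genuinely disjoint.\<close>

definition address :: "nat \<Rightarrow> 'a \<Rightarrow> nat set" where
  "address m x = {j. j < h m \<and> x \<in> (T ^^ j) ` F m}"

text \<open>These sets form a field: unions and complements of families of addresses give unions and
  complements of sets. Unions of tower cells have this property only modulo null sets.\<close>

definition addressed :: "nat \<Rightarrow> nat set set \<Rightarrow> 'a set" where
  "addressed m \<S> = {x \<in> space M. address m x \<in> \<S>}"

lemma level_sets: "m \<ge> 1 \<Longrightarrow> (T ^^ j) ` F m \<in> sets M"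
  using invertible_measure_preserving_funpow(4)[OF T F] .

lemma addressed_sets:
  assumes "m \<ge> 1"
  shows "addressed m \<S> \<in> sets M"
proof -
  have "{x \<in> space M. \<forall>j\<in>{..<h m}. (x \<in> (T ^^ j) ` F m) = (j \<in> J)} \<in> sets M" for J
    using level_sets[OF assms] by measurable
  moreover have "addressed m \<S> =
      (\<Union>J\<in>\<S> \<inter> Pow {..<h m}. {x \<in> space M. \<forall>j\<in>{..<h m}. (x \<in> (T ^^ j) ` F m) = (j \<in> J)})"
  proof (intro equalityI subsetI)
    fix x assume "x \<in> addressed m \<S>"
    then show "x \<in> (\<Union>J\<in>\<S> \<inter> Pow {..<h m}. {x \<in> space M. \<forall>j\<in>{..<h m}. (x \<in> (T ^^ j) ` F m) = (j \<in> J)})"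
      by (intro UN_I[of "address m x"]) (auto simp: addressed_def address_def)
  next
    fix x assume "x \<in> (\<Union>J\<in>\<S> \<inter> Pow {..<h m}. {x \<in> space M. \<forall>j\<in>{..<h m}. (x \<in> (T ^^ j) ` F m) = (j \<in> J)})"
    then obtain J where J: "J \<in> \<S>" "J \<subseteq> {..<h m}" "x \<in> space M"
      "\<forall>j\<in>{..<h m}. (x \<in> (T ^^ j) ` F m) = (j \<in> J)" by blast
    then have "address m x = J" by (auto simp: address_def)
    then show "x \<in> addressed m \<S>" using J by (simp add: addressed_def)
  qed
  moreover have "finite (\<S> \<inter> Pow {..<h m})" by simp
  ultimately show ?thesis by (auto intro!: sets.finite_UN)
qed

lemma tower_partition_sets:
  assumes "m \<ge> 1" "A \<in> tower_partition M T F h m"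
  shows "A \<in> sets M"
  using assms level_sets[OF assms(1)] by (auto simp: tower_partition_def tower_def)

lemma finite_tower_partition: "finite (tower_partition M T F h m)"
  by (simp add: tower_partition_def)

text \<open>Whether a point of the space lies in a cell depends on its address alone; the part
  outside the tower has the empty address.\<close>

lemma Union_tower_partition_addressed:
  assumes "m \<ge> 1" "\<D> \<subseteq> tower_partition M T F h m"
  shows "\<Union>\<D> = addressed m (address m ` \<Union>\<D>)"
proof (intro equalityI subsetI)
  fix x assume x: "x \<in> \<Union>\<D>"
  then have "x \<in> space M"
    using assms tower_partition_sets[THEN sets.sets_into_space] by blast
  with x show "x \<in> addressed m (address m ` \<Union>\<D>)" by (auto simp: addressed_def)
next
  fix y assume "y \<in> addressed m (address m ` \<Union>\<D>)"
  then obtain D x where D: "D \<in> \<D>" "x \<in> D" and y: "y \<in> space M" "address m y = address m x"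
    by (auto simp: addressed_def)
  have "D \<in> tower_partition M T F h m" using D assms by blast
  then consider "D = space M - tower T F h m" | j where "j < h m" "D = (T ^^ j) ` F m"
    by (auto simp: tower_partition_def)
  then have "y \<in> D"
  proof cases
    case 1
    then have "address m x = {}" using D by (auto simp: address_def tower_def)
    then have "address m y = {}" using y by simp
    then have "y \<notin> tower T F h m" by (auto simp: address_def tower_def)
    then show ?thesis using y 1 by simp
  next
    case 2
    then have "j \<in> address m x" using D by (simp add: address_def)
    then show ?thesis using y 2 by (auto simp: address_def)
  qed
  then show "y \<in> \<Union>\<D>" using D by blast
qed

section \<open>Approximation of measurable sets by late towers\<close>

lemma tower_partition_refines:
  assumes n: "n \<ge> 1" and A: "A \<in> tower_partition M T F h n" and "m \<ge> n"
  shows "\<exists>\<D>\<subseteq>tower_partition M T F h m. null_eq M A (\<Union>\<D>)"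
  using \<open>m \<ge> n\<close>
proof (induction m rule: dec_induct)
  case base
  show ?case using A by (intro exI[of _ "{A}"]) (auto simp: null_eq_def)
next
  case (step m)
  have m1: "m \<ge> 1" using step n by simp
  obtain \<D> where \<D>: "\<D> \<subseteq> tower_partition M T F h m" "null_eq M A (\<Union>\<D>)" using step by blast
  have "\<forall>D\<in>\<D>. \<exists>\<C>\<subseteq>tower_partition M T F h (Suc m). null_eq M D (\<Union>\<C>)"
    using refining[OF m1] \<D> by blast
  then obtain \<C> where \<C>: "\<And>D. D \<in> \<D> \<Longrightarrow> \<C> D \<subseteq> tower_partition M T F h (Suc m) \<and> null_eq M D (\<Union>(\<C> D))"
    by metis
  have fin: "finite \<D>" using \<D>(1) finite_tower_partition by (rule finite_subset)
  have sets: "\<Union>(\<C> D) \<in> sets M" if "D \<in> \<D>" for D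
  proof (rule sets.finite_Union)
    show "finite (\<C> D)" using \<C>[OF that] finite_tower_partition finite_subset by blast
    show "\<C> D \<subseteq> sets M" using \<C>[OF that] tower_partition_sets[of "Suc m"] by auto
  qed
  have "null_eq M (\<Union>D\<in>\<D>. D) (\<Union>D\<in>\<D>. \<Union>(\<C> D))"
    using \<C> sets \<D> tower_partition_sets[OF m1] by (intro null_eq_UN[OF fin]) auto
  moreover have eq: "\<Union>(\<Union>D\<in>\<D>. \<C> D) = (\<Union>D\<in>\<D>. \<Union>(\<C> D))" by blast
  ultimately have "null_eq M (\<Union>\<D>) (\<Union>(\<Union>D\<in>\<D>. \<C> D))" by simp
  moreover have "\<Union>(\<Union>D\<in>\<D>. \<C> D) \<in> sets M" unfolding eq using sets fin by (intro sets.finite_UN)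
  ultimately have "null_eq M A (\<Union>(\<Union>D\<in>\<D>. \<C> D))"
    using null_eq_trans[OF \<D>(2)] tower_partition_sets[OF n A] by blast
  moreover have "(\<Union>D\<in>\<D>. \<C> D) \<subseteq> tower_partition M T F h (Suc m)" using \<C> by blast
  ultimately show ?case by blast
qed

text \<open>The approximation must succeed for every m \<ge> N and not just for some m, because the
  level used later is dictated by n through \<open>slow_coding\<close>.\<close>

definition tower_approximable :: "'a set \<Rightarrow> bool" where
  "tower_approximable A \<longleftrightarrow> A \<in> sets M \<and>
     (\<forall>\<epsilon>>0. \<exists>N\<ge>1. \<forall>m\<ge>N. \<exists>\<S>. measure M (sym_diff A (addressed m \<S>)) < \<epsilon>)"

lemma tower_approximableD:
  assumes "tower_approximable A" "\<epsilon> > 0"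
  shows "\<exists>N\<ge>1. \<forall>m\<ge>N. \<exists>\<S>. measure M (sym_diff A (addressed m \<S>)) < \<epsilon>"
  using assms unfolding tower_approximable_def by blast

lemma tower_approximable_null_eq:
  assumes "null_eq M A B" "tower_approximable B" "A \<in> sets M"
  shows "tower_approximable A"
  unfolding tower_approximable_def
proof (intro conjI allI impI)
  fix \<epsilon> :: real assume "\<epsilon> > 0"
  then obtain N where N: "N \<ge> 1" "\<And>m. m \<ge> N \<Longrightarrow> \<exists>\<S>. measure M (sym_diff B (addressed m \<S>)) < \<epsilon>"
    using tower_approximableD[OF assms(2)] by blast
  have "\<exists>\<S>. measure M (sym_diff A (addressed m \<S>)) < \<epsilon>" if m: "m \<ge> N" for m
  proof -
    obtain \<S> where \<S>: "measure M (sym_diff B (addressed m \<S>)) < \<epsilon>" using N(2)[OF m] by blast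
    have [simp]: "addressed m \<S> \<in> sets M" "B \<in> sets M"
      using addressed_sets N m assms(2) by (auto simp: tower_approximable_def)
    have "measure M (sym_diff A (addressed m \<S>)) \<le> measure M (sym_diff B (addressed m \<S>) \<union> sym_diff A B)"
      using assms(3) by (intro finite_measure_mono sets.Un sets.Diff) auto
    also have "\<dots> = measure M (sym_diff B (addressed m \<S>))"
      using assms(1) by (intro measure_Un_null_set sets.Un sets.Diff) (auto simp: null_eq_def)
    finally show ?thesis using \<S> by (auto intro: le_less_trans)
  qed
  then show "\<exists>N\<ge>1. \<forall>m\<ge>N. \<exists>\<S>. measure M (sym_diff A (addressed m \<S>)) < \<epsilon>"
    using N(1) by blast
qed (rule assms(3))

lemma tower_approximable_tower_partition:
  assumes n: "n \<ge> 1" and A: "A \<in> tower_partition M T F h n"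
  shows "tower_approximable A"
  unfolding tower_approximable_def
proof (intro conjI allI impI)
  show "A \<in> sets M" using tower_partition_sets[OF n A] .
  fix \<epsilon> :: real assume "\<epsilon> > 0"
  have "\<exists>\<S>. measure M (sym_diff A (addressed m \<S>)) < \<epsilon>" if m: "m \<ge> n" for m
  proof -
    obtain \<D> where "\<D> \<subseteq> tower_partition M T F h m" "null_eq M A (\<Union>\<D>)"
      using tower_partition_refines[OF n A m] by blast
    moreover from this have "\<Union>\<D> = addressed m (address m ` \<Union>\<D>)"
      using n m by (intro Union_tower_partition_addressed) auto
    ultimately have "sym_diff A (addressed m (address m ` \<Union>\<D>)) \<in> null_sets M"
      by (simp add: null_eq_def)
    then show ?thesis
      using \<open>\<epsilon> > 0\<close> by (intro exI[of _ "address m ` \<Union>\<D>"]) (simp add: measure_eq_0_null_sets)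
  qed
  then show "\<exists>N\<ge>1. \<forall>m\<ge>N. \<exists>\<S>. measure M (sym_diff A (addressed m \<S>)) < \<epsilon>" using n by blast
qed

lemma tower_approximable_Un:
  assumes "tower_approximable A" "tower_approximable B"
  shows "tower_approximable (A \<union> B)"
  unfolding tower_approximable_def
proof (intro conjI allI impI)
  have [simp]: "A \<in> sets M" "B \<in> sets M" using assms by (auto simp: tower_approximable_def)
  then show "A \<union> B \<in> sets M" by (rule sets.Un)
  fix \<epsilon> :: real assume "\<epsilon> > 0"
  then have "\<epsilon> / 2 > 0" by simp
  obtain N where N: "N \<ge> 1" "\<And>m. m \<ge> N \<Longrightarrow> \<exists>\<S>. measure M (sym_diff A (addressed m \<S>)) < \<epsilon> / 2"
    using tower_approximableD[OF assms(1) \<open>\<epsilon> / 2 > 0\<close>] by blast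
  obtain N' where N': "N' \<ge> 1" "\<And>m. m \<ge> N' \<Longrightarrow> \<exists>\<S>. measure M (sym_diff B (addressed m \<S>)) < \<epsilon> / 2"
    using tower_approximableD[OF assms(2) \<open>\<epsilon> / 2 > 0\<close>] by blast
  have "\<exists>\<S>. measure M (sym_diff (A \<union> B) (addressed m \<S>)) < \<epsilon>" if m: "m \<ge> max N N'" for m
  proof -
    obtain \<S> \<S>' where S: "measure M (sym_diff A (addressed m \<S>)) < \<epsilon> / 2"
      "measure M (sym_diff B (addressed m \<S>')) < \<epsilon> / 2"
      using N(2)[of m] N'(2)[of m] m by auto
    have [simp]: "addressed m \<S> \<in> sets M" for \<S> using addressed_sets N(1) m by simp
    have "measure M (sym_diff (A \<union> B) (addressed m (\<S> \<union> \<S>')))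
        \<le> measure M (sym_diff A (addressed m \<S>) \<union> sym_diff B (addressed m \<S>'))"
      by (intro finite_measure_mono sets.Un sets.Diff) (simp_all, auto simp: addressed_def)
    also have "\<dots> \<le> measure M (sym_diff A (addressed m \<S>)) + measure M (sym_diff B (addressed m \<S>'))"
      by (intro measure_Un_le sets.Un sets.Diff) auto
    finally show ?thesis using S by (intro exI[of _ "\<S> \<union> \<S>'"]) linarith
  qed
  then show "\<exists>N\<ge>1. \<forall>m\<ge>N. \<exists>\<S>. measure M (sym_diff (A \<union> B) (addressed m \<S>)) < \<epsilon>"
    using N(1) by (intro exI[of _ "max N N'"]) auto
qed

lemma tower_approximable_compl:
  assumes "tower_approximable A"
  shows "tower_approximable (space M - A)"
  unfolding tower_approximable_def
proof (intro conjI allI impI)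
  have A: "A \<in> sets M" using assms by (auto simp: tower_approximable_def)
  then show "space M - A \<in> sets M" by simp
  fix \<epsilon> :: real assume "\<epsilon> > 0"
  then obtain N where N: "N \<ge> 1" "\<And>m. m \<ge> N \<Longrightarrow> \<exists>\<S>. measure M (sym_diff A (addressed m \<S>)) < \<epsilon>"
    using tower_approximableD[OF assms] by blast
  have eq: "sym_diff (space M - A) (addressed m (- \<S>)) = sym_diff A (addressed m \<S>)" for m \<S>
    using sets.sets_into_space[OF A] by (auto simp: addressed_def)
  have "\<exists>\<S>. measure M (sym_diff (space M - A) (addressed m \<S>)) < \<epsilon>" if m: "m \<ge> N" for m
  proof -
    obtain \<S> where "measure M (sym_diff A (addressed m \<S>)) < \<epsilon>" using N(2)[OF m] by blast
    then show ?thesis by (intro exI[of _ "- \<S>"]) (simp only: eq)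
  qed
  then show "\<exists>N\<ge>1. \<forall>m\<ge>N. \<exists>\<S>. measure M (sym_diff (space M - A) (addressed m \<S>)) < \<epsilon>"
    using N(1) by blast
qed

lemma tower_approximable_empty: "tower_approximable {}"
  unfolding tower_approximable_def
proof (intro conjI allI impI)
  fix \<epsilon> :: real assume "\<epsilon> > 0"
  then show "\<exists>N\<ge>1. \<forall>m\<ge>N. \<exists>\<S>. measure M (sym_diff {} (addressed m \<S>)) < \<epsilon>"
    by (intro exI[of _ 1]) (auto intro!: exI[of _ "{}"] simp: addressed_def)
qed simp

text \<open>Closedness in the pseudometric given by the measure of the symmetric difference.
  Countable unions need it: the thresholds N of the single sets may be unbounded, so a finite
  partial union is approximated instead.\<close>

lemma tower_approximable_limit:
  assumes A: "A \<in> sets M"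
    and "\<And>\<epsilon>. \<epsilon> > 0 \<Longrightarrow> \<exists>B. tower_approximable B \<and> measure M (sym_diff A B) < \<epsilon>"
  shows "tower_approximable A"
  unfolding tower_approximable_def
proof (intro conjI allI impI)
  fix \<epsilon> :: real assume "\<epsilon> > 0"
  then have "\<epsilon> / 2 > 0" by simp
  then obtain B where B: "tower_approximable B" "measure M (sym_diff A B) < \<epsilon> / 2"
    using assms(2) by blast
  then obtain N where N: "N \<ge> 1" "\<And>m. m \<ge> N \<Longrightarrow> \<exists>\<S>. measure M (sym_diff B (addressed m \<S>)) < \<epsilon> / 2"
    using tower_approximableD[OF B(1) \<open>\<epsilon> / 2 > 0\<close>] by blast
  have [simp]: "B \<in> sets M" using B by (simp add: tower_approximable_def)
  have "\<exists>\<S>. measure M (sym_diff A (addressed m \<S>)) < \<epsilon>" if m: "m \<ge> N" for m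
  proof -
    obtain \<S> where \<S>: "measure M (sym_diff B (addressed m \<S>)) < \<epsilon> / 2" using N(2)[OF m] by blast
    have [simp]: "addressed m \<S> \<in> sets M" using addressed_sets N(1) m by simp
    have "measure M (sym_diff A (addressed m \<S>)) \<le> measure M (sym_diff A B \<union> sym_diff B (addressed m \<S>))"
      using A by (intro finite_measure_mono sets.Un sets.Diff) auto
    also have "\<dots> \<le> measure M (sym_diff A B) + measure M (sym_diff B (addressed m \<S>))"
      using A by (intro measure_Un_le sets.Un sets.Diff) auto
    finally show ?thesis using \<S> B by (intro exI[of _ \<S>]) linarith
  qed
  then show "\<exists>N\<ge>1. \<forall>m\<ge>N. \<exists>\<S>. measure M (sym_diff A (addressed m \<S>)) < \<epsilon>" using N(1) by blast
qed (rule A)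

lemma tower_approximable_UN:
  fixes A :: "nat \<Rightarrow> 'a set"
  assumes A: "\<And>i. tower_approximable (A i)"
  shows "tower_approximable (\<Union>i. A i)"
proof (rule tower_approximable_limit)
  have As: "A i \<in> sets M" for i using A by (simp add: tower_approximable_def)
  then show "(\<Union>i. A i) \<in> sets M" by auto
  fix \<epsilon> :: real assume "\<epsilon> > 0"
  define B where "B = (\<lambda>k. \<Union>i<k. A i)"
  have Bs: "B k \<in> sets M" for k using As by (auto simp: B_def)
  have BA: "tower_approximable (B k)" for k
  proof (induction k)
    case (Suc k)
    have "B (Suc k) = B k \<union> A k" by (auto simp: B_def less_Suc_eq)
    then show ?case using tower_approximable_Un[OF Suc A] by simp
  qed (simp add: B_def tower_approximable_empty)
  have "(\<lambda>k. measure M ((\<Union>i. A i) - B k)) \<longlonglongrightarrow> measure M (\<Inter>k. (\<Union>i. A i) - B k)"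
    using Bs As by (intro finite_Lim_measure_decseq) (auto simp: decseq_def B_def)
  also have "(\<Inter>k. (\<Union>i. A i) - B k) = {}" by (auto simp: B_def)
  finally have "\<forall>\<^sub>F k in sequentially. measure M ((\<Union>i. A i) - B k) < \<epsilon>"
    using \<open>\<epsilon> > 0\<close> by (intro order_tendstoD(2)) auto
  then obtain k where k: "measure M ((\<Union>i. A i) - B k) < \<epsilon>"
    by (auto simp: eventually_sequentially)
  have "sym_diff (\<Union>i. A i) (B k) = (\<Union>i. A i) - B k" by (auto simp: B_def)
  then show "\<exists>B. tower_approximable B \<and> measure M (sym_diff (\<Union>i. A i) B) < \<epsilon>"
    using k BA by (intro exI[of _ "B k"]) simp
qed

text \<open>The approximable sets contain the tower cells and are closed under complements and
  countable unions, hence contain the generated \<sigma>-algebra; changes by null sets do not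
  matter.\<close>

lemma sets_tower_approximable:
  assumes A: "A \<in> sets M"
  shows "tower_approximable A"
proof -
  obtain B where B: "B \<in> sigma_sets (space M) (\<Union>m\<in>{1..}. tower_partition M T F h m)"
    and AB: "null_eq M A B"
    using generating[OF A] by blast
  from B have "tower_approximable B"
    by induction (auto intro: tower_approximable_tower_partition tower_approximable_empty
        tower_approximable_compl tower_approximable_UN)
  then show ?thesis by (rule tower_approximable_null_eq[OF AB _ A])
qed

text \<open>Each cell C is approximated by the points with address in some S C. Off the union E of
  the errors, membership in C is equivalent to having an address in S C, so any C with the address
  of x in S C contains x.\<close>

lemma partition_determined_by_address:
  assumes \<xi>: "finite_measurable_partition M \<xi>" and ne: "\<xi> \<noteq> {}" and \<epsilon>: "\<epsilon> > 0"
  obtains N where "N \<ge> 1" "\<And>m. m \<ge> N \<Longrightarrow> \<exists>d E. E \<in> sets M \<and> measure M E < \<epsilon> \<and>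
      range d \<subseteq> \<xi> \<and> (\<forall>x\<in>space M - E. x \<in> d (address m x))"
proof -
  have fin: "finite \<xi>" and sets: "\<And>C. C \<in> \<xi> \<Longrightarrow> C \<in> sets M" and P: "partition_on (space M) \<xi>"
    using \<xi> by (auto simp: finite_measurable_partition_def)
  have c0: "card \<xi> > 0" using fin ne by (simp add: card_gt_0_iff)
  define \<eta> where "\<eta> = \<epsilon> / real (card \<xi>)"
  have "\<eta> > 0" using \<epsilon> c0 by (simp add: \<eta>_def)
  then have "\<forall>C\<in>\<xi>. \<exists>N\<ge>1. \<forall>m\<ge>N. \<exists>\<S>. measure M (sym_diff C (addressed m \<S>)) < \<eta>"
    using tower_approximableD[OF sets_tower_approximable[OF sets]] by blast
  then obtain N where N: "\<And>C m. C \<in> \<xi> \<Longrightarrow> m \<ge> N C \<Longrightarrow> \<exists>\<S>. measure M (sym_diff C (addressed m \<S>)) < \<eta>"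
    by metis
  show thesis
  proof (rule that)
    show "Max (insert 1 (N ` \<xi>)) \<ge> 1" using fin by auto
    fix m assume m: "m \<ge> Max (insert 1 (N ` \<xi>))"
    then have m1: "m \<ge> 1" and mN: "\<And>C. C \<in> \<xi> \<Longrightarrow> m \<ge> N C" using fin by auto
    have "\<forall>C\<in>\<xi>. \<exists>\<S>. measure M (sym_diff C (addressed m \<S>)) < \<eta>" using N mN by blast
    from bchoice[OF this] obtain S
      where S: "\<And>C. C \<in> \<xi> \<Longrightarrow> measure M (sym_diff C (addressed m (S C))) < \<eta>" by blast
    define E where "E = (\<Union>C\<in>\<xi>. sym_diff C (addressed m (S C)))"
    \<comment> \<open>The families S C may overlap or miss an address. The choice is immaterial off
      E, and the default cell keeps every value of d in \<xi>, as code letters require.\<close>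
    define d where "d = (\<lambda>J. if \<exists>C\<in>\<xi>. J \<in> S C then SOME C. C \<in> \<xi> \<and> J \<in> S C else SOME C. C \<in> \<xi>)"
    have Es: "sym_diff C (addressed m (S C)) \<in> sets M" if "C \<in> \<xi>" for C
      using sets[OF that] addressed_sets[OF m1] by auto
    have d: "d J \<in> \<xi>" "\<exists>C\<in>\<xi>. J \<in> S C \<Longrightarrow> J \<in> S (d J)" for J
    proof -
      show "J \<in> S (d J)" if "\<exists>C\<in>\<xi>. J \<in> S C"
        using that someI_ex[of "\<lambda>C. C \<in> \<xi> \<and> J \<in> S C"] by (auto simp: d_def)
      show "d J \<in> \<xi>"
        using someI_ex[of "\<lambda>C. C \<in> \<xi> \<and> J \<in> S C"] someI_ex[of "\<lambda>C. C \<in> \<xi>"] ne by (auto simp: d_def)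
    qed
    have "measure M E \<le> (\<Sum>C\<in>\<xi>. measure M (sym_diff C (addressed m (S C))))"
      unfolding E_def using fin Es by (intro finite_measure_subadditive_finite) auto
    also have "\<dots> < (\<Sum>C\<in>\<xi>. \<eta>)"
      using fin ne S by (intro sum_strict_mono) auto
    also have "\<dots> = \<epsilon>" using c0 by (simp add: \<eta>_def)
    finally have "measure M E < \<epsilon>" .
    moreover have "E \<in> sets M" unfolding E_def using fin Es by (rule sets.finite_UN)
    moreover have "x \<in> d (address m x)" if x: "x \<in> space M" "x \<notin> E" for x
    proof -
      obtain C where C: "C \<in> \<xi>" "x \<in> C" using x partition_onD1[OF P] by blast
      have *: "x \<in> C' \<longleftrightarrow> address m x \<in> S C'" if "C' \<in> \<xi>" for C'
        using that x by (auto simp: E_def addressed_def)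
      then have "address m x \<in> S (d (address m x))" using C by (intro d(2)) auto
      then show ?thesis using * d(1) by blast
    qed
    ultimately show "\<exists>d E. E \<in> sets M \<and> measure M E < \<epsilon> \<and>
      range d \<subseteq> \<xi> \<and> (\<forall>x\<in>space M - E. x \<in> d (address m x))"
      using d(1) by (intro exI[of _ d] exI[of _ E]) auto
  qed
qed

section \<open>Codes for address histories\<close>

text \<open>The address of \<open>T\<^sup>i x\<close> is read off the visit times of \<open>T\<^sup>-\<^sup>h x\<close> to the base, of which
  every block of length \<open>h\<close> contains at most one; \<open>u b = h\<close> encodes a block without visits.\<close>

lemma address_code:
  fixes L :: nat
  assumes m: "m \<ge> 1"
  defines "U \<equiv> {..<L div h m + 2} \<rightarrow>\<^sub>E {..h m}"
  shows "\<exists>\<Phi>. AE x in M. \<exists>u\<in>U. \<forall>i\<le>L. address m ((T ^^ i) x) = \<Phi> u i"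
proof -
  define H where "H = h m"
  have H: "H \<ge> 1" using h_pos[OF m] by (simp add: H_def)
  note pow = invertible_measure_preserving_funpow[OF T]
  have Fsp: "F m \<subseteq> space M" using F[OF m] by (rule sets.sets_into_space)
  have sp: "(T ^^ k) x \<in> space M" if "x \<in> space M" for k x
    using bij_betwE[OF pow(1)] that by blast
  \<comment> \<open>Being on level j at time i means having been in the base j steps earlier.
    Starting H steps in the past makes this time i + H - j nonnegative; it is split into its block
    and its offset there. The value H is never an offset.\<close>
  define \<Phi> where "\<Phi> = (\<lambda>(u :: nat \<Rightarrow> nat) i. {j. j < H \<and> u ((i + H - j) div H) = (i + H - j) mod H})"
  \<comment> \<open>Two base visits at distance j < H put the later point on both the base and level
    j; Z collects the starting points for which this can happen.\<close>
  define Z where "Z = (\<Union>k\<in>{..L + H}. \<Union>j\<in>{1..<H}. (T ^^ k) -` ((T ^^ 0) ` F m \<inter> (T ^^ j) ` F m) \<inter> space M)"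
  have Z: "Z \<in> null_sets M"
    unfolding Z_def
  proof (intro null_sets_UN' countable_finite)
    fix k j assume "j \<in> {1..<H}"
    then have N: "(T ^^ 0) ` F m \<inter> (T ^^ j) ` F m \<in> null_sets M"
      by (intro levels_disjoint[OF m]) (auto simp: H_def)
    then have "(T ^^ 0) ` F m \<inter> (T ^^ j) ` F m \<in> sets M" by auto
    with N show "(T ^^ k) -` ((T ^^ 0) ` F m \<inter> (T ^^ j) ` F m) \<inter> space M \<in> null_sets M"
      by (metis measurable_sets[OF pow(2)] null_setsD1 null_setsI pow(3))
  qed auto
  \<comment> \<open>The exceptional set concerns z, but the statement is about x =
    \<open>(T ^^ H) z\<close>.\<close>
  have Zim: "(T ^^ H) ` Z \<in> null_sets M"
  proof (rule null_setsI)
    have Zs: "Z \<in> sets M" using Z by auto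
    have "(T ^^ H) -` (T ^^ H) ` Z \<inter> space M = Z"
      using bij_betw_imp_inj_on[OF pow(1)] sets.sets_into_space[OF Zs] by (auto simp: inj_on_def)
    then show "emeasure M ((T ^^ H) ` Z) = 0"
      using pow(3)[OF pow(4)[OF Zs], of H H] Z by auto
    show "(T ^^ H) ` Z \<in> sets M" by (rule pow(4)[OF Zs])
  qed
  have "\<exists>u\<in>U. \<forall>i\<le>L. address m ((T ^^ i) x) = \<Phi> u i" if x: "x \<in> space M - (T ^^ H) ` Z" for x
  proof -
    obtain z where z: "z \<in> space M" "x = (T ^^ H) z" "z \<notin> Z"
      using x bij_betw_imp_surj_on[OF pow(1), of H] by blast
    define V where "V = (\<lambda>s. (T ^^ s) z \<in> F m)"
    have uniq: "s = s'" if s: "V s" "V s'" "s \<le> s'" "s' \<le> L + H" "s div H = s' div H" for s s'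
    proof (rule ccontr)
      assume "s \<noteq> s'"
      define j where "j = s' - s"
      have "s' = H * (s' div H) + s' mod H" "s = H * (s' div H) + s mod H"
        using mult_div_mod_eq[of H s'] mult_div_mod_eq[of H s] s by simp_all
      moreover have "s' mod H < H" using H by simp
      ultimately have "s' - s < H" by linarith
      then have j: "j \<in> {1..<H}" "s' = j + s"
        using \<open>s \<noteq> s'\<close> s by (auto simp: j_def)
      have "(T ^^ s') z = (T ^^ j) ((T ^^ s) z)" unfolding j(2) by (simp add: funpow_add)
      then have "(T ^^ s') z \<in> (T ^^ j) ` F m" "(T ^^ s') z \<in> (T ^^ 0) ` F m"
        using s by (auto simp: V_def)
      then have "z \<in> Z" unfolding Z_def using s j z(1) by blast
      then show False using z by simp
    qed
    define u where "u = restrict (\<lambda>b. if \<exists>s\<le>L + H. s div H = b \<and> V s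
        then (THE s. s \<le> L + H \<and> s div H = b \<and> V s) mod H else H) {..<L div H + 2}"
    have u: "u (s div H) = s mod H \<longleftrightarrow> V s" if s: "s \<le> L + H" for s
    proof -
      \<comment> \<open>The times run up to L + H, so the last block has number L div H + 1; this
        gives L div H + 2 blocks.\<close>
      have "s div H \<le> (L + H) div H" using s by (rule div_le_mono)
      also have "\<dots> = L div H + 1" using H by simp
      finally have b: "s div H < L div H + 2" by simp
      show ?thesis
      proof (cases "\<exists>s'\<le>L + H. s' div H = s div H \<and> V s'")
        case True
        then obtain s' where s': "s' \<le> L + H" "s' div H = s div H" "V s'" by blast
        have "(THE r. r \<le> L + H \<and> r div H = s div H \<and> V r) = s'"
        proof (rule the_equality)
          fix r assume "r \<le> L + H \<and> r div H = s div H \<and> V r"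
          then show "r = s'" using uniq[of r s'] uniq[of s' r] s' by (cases "r \<le> s'") auto
        qed (use s' in simp)
        then have "u (s div H) = s' mod H" using True b by (simp add: u_def)
        moreover have "s' mod H = s mod H \<longleftrightarrow> s' = s"
          using s'(2) by (metis div_mult_mod_eq)
        moreover have "V s \<Longrightarrow> s' = s"
          by (metis uniq s' s nat_le_linear)
        ultimately show ?thesis using s' by auto
      next
        case False
        then have "u (s div H) = H" "\<not> V s" using b s by (auto simp: u_def)
        moreover have "s mod H < H" using H by simp
        ultimately show ?thesis by linarith
      qed
    qed
    have "u \<in> U"
      unfolding U_def H_def[symmetric] u_def using H
      by (auto intro!: less_imp_le[OF mod_less_divisor])
    moreover have "address m ((T ^^ i) x) = \<Phi> u i" if i: "i \<le> L" for i
    proof -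
      have "(T ^^ i) x \<in> (T ^^ j) ` F m \<longleftrightarrow> V (i + H - j)" if j: "j < H" for j
      proof -
        have "(T ^^ i) x = (T ^^ (j + (i + H - j))) z" using j z by (simp add: funpow_add)
        also have "\<dots> = (T ^^ j) ((T ^^ (i + H - j)) z)" by (simp only: funpow_add o_apply)
        finally show ?thesis
          using bij_betw_imp_inj_on[OF pow(1), of j] sp[OF z(1)] Fsp
          by (simp add: V_def inj_on_image_mem_iff)
      qed
      then show ?thesis
        using i u by (auto simp: address_def \<Phi>_def H_def[symmetric])
    qed
    ultimately show ?thesis by blast
  qed
  then have "AE x in M. \<exists>u\<in>U. \<forall>i\<le>L. address m ((T ^^ i) x) = \<Phi> u i"
    by (intro AE_I'[OF Zim]) blast
  then show ?thesis by blast
qed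

section \<open>Vanishing of the sequence entropy\<close>

lemma sequence_entropy_wrt_le_0:
  assumes pos: "measure M (space M) > 0"
    and mono: "\<And>k n. 1 \<le> k \<Longrightarrow> k \<le> n \<Longrightarrow> t k \<le> t n" and slow: "slow_coding t h"
    and \<xi>: "finite_measurable_partition M \<xi>"
  shows "sequence_entropy_wrt M T t \<xi> \<le> 0"
proof (rule ereal_le_epsilon2)
  fix \<epsilon> :: real assume \<epsilon>: "\<epsilon> > 0"
  \<comment> \<open>The bound of \<open>entropy_le_code\<close> has four terms: the constant 1, the
    number of codes, the smoothing by \<delta> and the visits to E. Each receives a budget of
    \<epsilon>/4 n.\<close>
  define c where "c = measure M (space M)"
  note pow = invertible_measure_preserving_funpow[OF T]
  have "space M \<noteq> {}" using pos by auto
  then have ne: "\<xi> \<noteq> {}" using \<xi> by (auto simp: finite_measurable_partition_def partition_on_def)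
  have c0: "card \<xi> > 0" using \<xi> ne by (simp add: card_gt_0_iff finite_measurable_partition_def)
  \<comment> \<open>This solves c * - ln (1 - \<delta>) = \<epsilon>/4. It is fixed before E,
    because the price l of a visit to E depends on \<delta>.\<close>
  define \<delta> where "\<delta> = 1 - exp (- (\<epsilon> / (4 * c)))"
  have \<delta>: "0 < \<delta>" "\<delta> < 1" using \<epsilon> pos by (auto simp: \<delta>_def c_def)
  have \<delta>c: "- ln (1 - \<delta>) = \<epsilon> / (4 * c)" by (simp add: \<delta>_def)
  define l where "l = ln (real (card \<xi>) / \<delta>)"
  have l0: "l \<ge> 0" unfolding l_def using \<delta> c0 by (intro ln_ge_zero) (simp add: field_simps)
  have "\<epsilon> / (4 * (l + 1)) > 0" using \<epsilon> l0 by simp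
  then obtain N where N: "N \<ge> 1" "\<And>m. m \<ge> N \<Longrightarrow> \<exists>d E. E \<in> sets M \<and> measure M E < \<epsilon> / (4 * (l + 1)) \<and>
      range d \<subseteq> \<xi> \<and> (\<forall>x\<in>space M - E. x \<in> d (address m x))"
    using partition_determined_by_address[OF \<xi> ne] by metis
  have "\<epsilon> / (4 * c) > 0" using \<epsilon> pos by (simp add: c_def)
  then have "\<forall>\<^sub>F n in sequentially. \<exists>m\<ge>N. (real (t n) / real (h m) + 2) * ln (real (h m) + 1) \<le> \<epsilon> / (4 * c) * real n"
    using slow unfolding slow_coding_def by blast
  moreover have "\<forall>\<^sub>F n in sequentially. 1 \<le> \<epsilon> / 4 * real n" using \<epsilon> by real_asymp
  ultimately have "\<forall>\<^sub>F n in sequentially. ereal (1 / real n *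
       partition_entropy M (common_refinement ((\<lambda>k. preimage_partition M T (t k) \<xi>) ` {1..n}))) \<le> ereal \<epsilon>"
    using eventually_gt_at_top[of 0]
  proof eventually_elim
    case (elim n)
    then obtain m where m: "m \<ge> N" "(real (t n) / real (h m) + 2) * ln (real (h m) + 1) \<le> \<epsilon> / (4 * c) * real n"
      by blast
    have m1: "m \<ge> 1" using m N by simp
    obtain d E where E: "E \<in> sets M" "measure M E < \<epsilon> / (4 * (l + 1))" and d: "range d \<subseteq> \<xi>"
      and dE: "\<And>x. x \<in> space M \<Longrightarrow> x \<notin> E \<Longrightarrow> x \<in> d (address m x)"
      using N(2)[OF m(1)] by blast
    define U where "U = {..<t n div h m + 2} \<rightarrow>\<^sub>E {..h m}"
    obtain \<Phi> where \<Phi>: "AE x in M. \<exists>u\<in>U. \<forall>i\<le>t n. address m ((T ^^ i) x) = \<Phi> u i"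
      unfolding U_def using address_code[OF m1] by blast
    have finU: "finite U" "U \<noteq> {}" by (auto simp: U_def PiE_eq_empty_iff intro!: finite_PiE)
    \<comment> \<open>Monotonicity puts all \<open>t k\<close> with k \<le> n among the coded times
      up to \<open>t n\<close>.\<close>
    have code: "AE x in M. \<exists>u\<in>U. \<forall>k\<in>{1..n}. (T ^^ t k) x \<in> d (\<Phi> u (t k)) \<or> (T ^^ t k) x \<in> E"
    proof -
      have "AE x in M. x \<in> space M" by simp
      with \<Phi> show ?thesis
      proof eventually_elim
        case (elim x)
        then obtain u where u: "u \<in> U" "\<forall>i\<le>t n. address m ((T ^^ i) x) = \<Phi> u i" by blast
        have "(T ^^ t k) x \<in> d (\<Phi> u (t k)) \<or> (T ^^ t k) x \<in> E" if "k \<in> {1..n}" for k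
        proof -
          have "address m ((T ^^ t k) x) = \<Phi> u (t k)" using u mono that by simp
          moreover have "(T ^^ t k) x \<in> space M" using bij_betwE[OF pow(1)] elim by blast
          ultimately show ?thesis using dE by metis
        qed
        then show ?case using u by blast
      qed
    qed
    have "partition_entropy M (common_refinement ((\<lambda>k. (\<lambda>C. (T ^^ t k) -` C \<inter> space M) ` \<xi>) ` {1..n}))
          \<le> 1 + measure M (space M) * (ln (real (card U)) + real (card {1..n}) * - ln (1 - \<delta>))
            + real (card {1..n}) * measure M E * ln (real (card \<xi>) / \<delta>)"
    proof (rule entropy_le_code[where \<Phi> = "\<lambda>u k. d (\<Phi> u (t k))"])
      show "finite_measure M" by unfold_locales
      show "measure M ((T ^^ t k) -` A \<inter> space M) = measure M A" if "A \<in> sets M" for k A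
        using pow(3)[OF that] by (simp add: measure_def)
    qed (use \<xi> pow(2) finU d E(1) code \<delta> elim(3) in auto)
    also have "\<dots> = 1 + c * ln (real (card U)) + real n * (\<epsilon> / 4) + real n * (measure M E * l)"
      using pos unfolding \<delta>c l_def[symmetric] c_def[symmetric] by (simp add: algebra_simps c_def)
    also have "\<dots> \<le> \<epsilon> * real n"
    proof -
      have "ln (real (card U)) = real (t n div h m + 2) * ln (real (h m) + 1)"
      proof -
        have "real (card U) = (real (h m) + 1) ^ (t n div h m + 2)"
          by (simp add: U_def card_PiE add.commute del: power_Suc)
        then show ?thesis by (simp only: ln_realpow)
      qed
      also have "\<dots> \<le> (real (t n) / real (h m) + 2) * ln (real (h m) + 1)"
        by (intro mult_right_mono) (auto simp: of_nat_div_le_of_nat)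
      also note m(2)
      finally have "c * ln (real (card U)) \<le> c * (\<epsilon> / (4 * c) * real n)"
        using pos by (intro mult_left_mono) (auto simp: c_def)
      also have "\<dots> = \<epsilon> / 4 * real n" using pos by (simp add: c_def)
      finally have 1: "c * ln (real (card U)) \<le> \<epsilon> / 4 * real n" .
      have "measure M E * l \<le> \<epsilon> / (4 * (l + 1)) * (l + 1)"
        using E l0 \<epsilon> by (intro mult_mono) auto
      also have "\<dots> = \<epsilon> / 4" using l0 by (simp add: divide_simps)
      finally have "measure M E * l \<le> \<epsilon> / 4" .
      then have 2: "real n * (measure M E * l) \<le> real n * (\<epsilon> / 4)" by (intro mult_left_mono) auto
      show ?thesis using 1 2 elim(2) by (simp add: algebra_simps)
    qed
    finally show ?case using elim(3) by (simp add: preimage_partition_def field_simps)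
  qed
  then have "sequence_entropy_wrt M T t \<xi> \<le> ereal \<epsilon>"
    unfolding sequence_entropy_wrt_def by (rule Limsup_bounded)
  then show "sequence_entropy_wrt M T t \<xi> \<le> 0 + ereal \<epsilon>" by simp
qed

text \<open>A witness for the lower bound of the supremum. Entropies can be negative when the total
  mass exceeds 1, so nonnegativity is not automatic; here the entropy is a constant, which
  disappears after division by n.\<close>

lemma sequence_entropy_wrt_trivial:
  assumes "space M \<noteq> {}"
  shows "sequence_entropy_wrt M T t {space M} = 0"
proof -
  have "preimage_partition M T k {space M} = {space M}" for k
    using bij_betwE[OF invertible_measure_preserving_funpow(1)[OF T, of k]]
    by (auto simp: preimage_partition_def)
  then have "partition_entropy M (common_refinement ((\<lambda>k. preimage_partition M T (t k) {space M}) ` {1..n}))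
      = entropy_fun (measure M (space M))" if "n \<ge> 1" for n
    using that common_refinement_singleton[OF assms]
    by (simp add: partition_entropy_def image_constant_conv)
  then have "sequence_entropy_wrt M T t {space M}
      = limsup (\<lambda>n. ereal (1 / real n * entropy_fun (measure M (space M))))"
    unfolding sequence_entropy_wrt_def
    by (intro Limsup_eq eventually_mono[OF eventually_ge_at_top[of 1]]) simp
  also have "\<dots> = 0"
  proof (rule lim_imp_Limsup)
    have "(\<lambda>n. 1 / real n * entropy_fun (measure M (space M))) \<longlonglongrightarrow> 0" by real_asymp
    then show "(\<lambda>n. ereal (1 / real n * entropy_fun (measure M (space M)))) \<longlonglongrightarrow> 0"
      by (simp add: zero_ereal_def)
  qed simp
  finally show ?thesis .
qed

lemma sequence_entropy_eq_0:
  assumes pos: "measure M (space M) > 0"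
    and mono: "\<And>k n. 1 \<le> k \<Longrightarrow> k \<le> n \<Longrightarrow> t k \<le> t n" and slow: "slow_coding t h"
  shows "sequence_entropy M T t = 0"
proof (rule antisym)
  show "sequence_entropy M T t \<le> 0"
    unfolding sequence_entropy_def
    using sequence_entropy_wrt_le_0[OF pos mono slow] by (auto intro!: SUP_least)
  have ne: "space M \<noteq> {}" using pos by auto
  then have "finite_measurable_partition M {space M}"
    by (auto simp: finite_measurable_partition_def partition_on_def)
  then show "0 \<le> sequence_entropy M T t"
    unfolding sequence_entropy_def using sequence_entropy_wrt_trivial[OF ne]
    by (metis (mono_tags, lifting) SUP_upper mem_Collect_eq)
qed

end

lemma rank_one_generating_towers:
  assumes fM: "finite_measure M" and T: "invertible_measure_preserving M T"
    and R: "rank_one_approximated M T F h"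
  shows "generating_towers M T F h" "h 1 \<ge> 1" "\<forall>m\<ge>1. h m < h (Suc m)"
proof -
  have R': "h 1 \<ge> 1 \<and> (\<forall>m\<ge>1. h m < h (Suc m)) \<and>
      (\<forall>m\<ge>1. F m \<in> sets M \<and> emeasure M (F m) > 0) \<and>
      (\<forall>m\<ge>1. \<forall>i<h m. \<forall>j<h m. i \<noteq> j \<longrightarrow> (T ^^ i) ` F m \<inter> (T ^^ j) ` F m \<in> null_sets M) \<and>
      (\<forall>m\<ge>1. \<forall>A\<in>tower_partition M T F h m.
         \<exists>\<C>\<subseteq>tower_partition M T F h (Suc m). null_eq M A (\<Union>\<C>)) \<and>
      (\<forall>A\<in>sets M. \<exists>B\<in>sigma_sets (space M) (\<Union>m\<in>{1..}. tower_partition M T F h m). null_eq M A B)"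
    using R unfolding rank_one_approximated_def by (elim exE conjE) (intro conjI; assumption)
  note h = R'[THEN conjunct1] R'[THEN conjunct2, THEN conjunct1]
  show "h 1 \<ge> 1" "\<forall>m\<ge>1. h m < h (Suc m)" by (rule h)+
  have hpos: "h m \<ge> 1" if "m \<ge> 1" for m
    using that by (induction m rule: dec_induct) (use h in \<open>auto intro: le_trans less_imp_le\<close>)
  note R'' = R'[THEN conjunct2, THEN conjunct2]
  note F = R''[THEN conjunct1] and disj = R''[THEN conjunct2, THEN conjunct1]
    and refine = R''[THEN conjunct2, THEN conjunct2, THEN conjunct1]
    and gen = R''[THEN conjunct2, THEN conjunct2, THEN conjunct2]
  interpret finite_measure M by (rule fM)
  show "generating_towers M T F h"
  proof
    show "F m \<in> sets M" if "m \<ge> 1" for m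
      using F that by simp
    show "(T ^^ i) ` F m \<inter> (T ^^ j) ` F m \<in> null_sets M"
      if "m \<ge> 1" "i < h m" "j < h m" "i \<noteq> j" for m i j
      using disj[rule_format, OF that] .
    show "\<exists>\<C>\<subseteq>tower_partition M T F h (Suc m). null_eq M A (\<Union>\<C>)"
      if "m \<ge> 1" "A \<in> tower_partition M T F h m" for m A
      using refine[rule_format, OF that] .
    show "\<exists>B\<in>sigma_sets (space M) (\<Union>m\<in>{1..}. tower_partition M T F h m). null_eq M A B"
      if "A \<in> sets M" for A
      using gen[rule_format, OF that] .
  qed (fact T hpos)+
qed

theorem theorem1p7:
  fixes M :: "'a measure" and T :: "'a \<Rightarrow> 'a" and F :: "nat \<Rightarrow> 'a set" and h :: "nat \<Rightarrow> nat"
  assumes "standard_measure_space M"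
    and "finite_measure M"
    and "measure M (space M) > 0"
    and "invertible_measure_preserving M T"
    and "rank_one_approximated M T F h"
  shows
    "(\<forall>t :: nat \<Rightarrow> nat.
        strict_mono_on {1..} t \<and> subexponential t \<and>
        limsup (\<lambda>n. ereal (ln (real (h (Suc n))) / ln (real (h n)))) < \<infinity>
        \<longrightarrow> sequence_entropy M T t = 0) \<and>
     (\<forall>(t :: nat \<Rightarrow> nat) (\<alpha> :: real).
        strict_mono_on {1..} t \<and> \<alpha> > 1 \<and>
        (\<lambda>n. real (t n)) \<in> O(\<lambda>n. real n powr \<alpha>) \<and>
        (\<exists>\<beta>\<in>{0<..<1 / (\<alpha> - 1)}.
           limsup (\<lambda>n. ereal (ln (real (h (Suc n))) / real (h n) powr \<beta>)) < \<infinity>)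
        \<longrightarrow> sequence_entropy M T t = 0) \<and>
     (\<forall>(C :: real) (\<alpha> :: real).
        C > 0 \<and> \<alpha> > 0 \<and>
        (\<exists>\<beta>\<in>{0<..<1 / \<alpha>}.
           limsup (\<lambda>n. ereal (ln (real (h (Suc n))) / exp (real (h n) powr \<beta>))) < \<infinity>)
        \<longrightarrow> sequence_entropy M T (\<lambda>n. nat \<lfloor>C * real n * ln (real n) powr \<alpha>\<rfloor>) = 0)"
proof -
  note R = rank_one_generating_towers[OF assms(2,4,5)]
  interpret generating_towers M T F h by (rule R(1))
  note zero = sequence_entropy_eq_0[OF assms(3)]
  have mono: "t k \<le> t n" if "strict_mono_on {1..} t" "1 \<le> k" "k \<le> n" for t :: "nat \<Rightarrow> nat" and k n
    using strict_mono_on_leD[OF that(1), of k n] that by auto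
  show ?thesis
  proof (intro conjI allI impI)
    fix t :: "nat \<Rightarrow> nat"
    assume "strict_mono_on {1..} t \<and> subexponential t \<and>
        limsup (\<lambda>n. ereal (ln (real (h (Suc n))) / ln (real (h n)))) < \<infinity>"
    then show "sequence_entropy M T t = 0"
      using slow_coding_subexponential[OF R(2,3)] mono by (intro zero) auto
  next
    fix t :: "nat \<Rightarrow> nat" and \<alpha> :: real
    assume "strict_mono_on {1..} t \<and> \<alpha> > 1 \<and>
        (\<lambda>n. real (t n)) \<in> O(\<lambda>n. real n powr \<alpha>) \<and>
        (\<exists>\<beta>\<in>{0<..<1 / (\<alpha> - 1)}.
           limsup (\<lambda>n. ereal (ln (real (h (Suc n))) / real (h n) powr \<beta>)) < \<infinity>)"
    then show "sequence_entropy M T t = 0"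
      using slow_coding_power[OF R(2,3)] mono by (intro zero) auto
  next
    fix C \<alpha> :: real
    assume A: "C > 0 \<and> \<alpha> > 0 \<and>
        (\<exists>\<beta>\<in>{0<..<1 / \<alpha>}.
           limsup (\<lambda>n. ereal (ln (real (h (Suc n))) / exp (real (h n) powr \<beta>))) < \<infinity>)"
    show "sequence_entropy M T (\<lambda>n. nat \<lfloor>C * real n * ln (real n) powr \<alpha>\<rfloor>) = 0"
    proof (rule zero)
      show "slow_coding (\<lambda>n. nat \<lfloor>C * real n * ln (real n) powr \<alpha>\<rfloor>) h"
        using slow_coding_n_log[OF R(2,3)] A by auto
      \<comment> \<open>This sequence need not be strictly increasing at its start, but weak
        monotonicity is enough; k \<ge> 1 makes \<open>ln k\<close> nonnegative, as monotonicity of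
        the power requires.\<close>
      fix k n :: nat assume "1 \<le> k" "k \<le> n"
      then show "nat \<lfloor>C * real k * ln (real k) powr \<alpha>\<rfloor> \<le> nat \<lfloor>C * real n * ln (real n) powr \<alpha>\<rfloor>"
        using A by (intro nat_mono floor_mono mult_mono powr_mono2) auto
    qed
  qed
qed

end
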